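(* Let $\mathcal{H}$ be a real Hilbert space, $\gamma,\lambda>0$, $u_0,v_0\in\mathcal{H}$, and assume: (1) $\Psi:\mathcal{H}\to[0,+\infty)$ is convex and twice differentiable, $\nabla\Psi$ and $\nabla^2\Psi$ are Lipschitz continuous, and $\operatorname{argmin}\Psi=\Psi^{-1}(0)\neq\emptyset$; (2) $\Phi:\mathcal{H}\to\mathbb{R}$ is convex, twice differentiable and bounded from below, $\nabla\Phi$ and $\nabla^2\Phi$ are Lipschitz continuous, and $S:=\{z\in\operatorname{argmin}\Psi:\ \Phi(z)\le\Phi(x)\ \ \forall x\in\operatorname{argmin}\Psi\}\neq\emptyset$; (3) $\beta:[0,+\infty)\to(0,+\infty)$ is a $C^1$ function with $\lim_{t\to+\infty}\beta(t)=+\infty$ and $0\le\dot\beta(t)\le k\beta(t)$ for all $t\ge 0$, where $0<k<\frac{\theta}{1+\lambda\gamma}\min\left\{\frac{2\gamma}{3},\frac{2}{\lambda}\right\}$ for some $\theta\in(0,1)$; (4) for every $p\in\operatorname{ran}N_{\operatorname{argmin}\Psi}$, $$\int_0^{+\infty}\beta(t)\left[\Psi^*\left(\frac{p}{\beta(t)}\right)-\sigma_{\operatorname{argmin}\Psi}\left(\frac{p}{\beta(t)}\right)\right]dt<+\infty.$$ Let $x:[0,+\infty)\to\mathcal{H}$ be the strong global solution of $$\ddot x(t)+\gamma\dot x(t)+\lambda\nabla^2\Phi(x(t))(\dot x(t))+\lambda\beta(t)\nabla^2\Psi(x(t))(\dot x(t))+\nabla\Phi(x(t))+(\beta(t)+\lambda\dot\beta(t))\nabla\Psi(x(t))=0,$$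 $$x(0)=u_0,\quad \dot x(0)=v_0.$$ Then the following statements are true: (i) $\Phi(x(t))$ converges to $\inf_{y\in\operatorname{argmin}\Psi}\Phi(y)$ as $t\to+\infty$; (ii) $\lim_{t\to+\infty}\beta(t)\Psi(x(t))=\lim_{t\to+\infty}\Psi(x(t))=0$; (iii) $\int_0^{+\infty}\beta(t)\Psi(x(t))\,dt<+\infty$; (iv) $\dot x\in L^2([0,+\infty);\mathcal{H})$ and $\nabla\Phi(x)+\beta\nabla\Psi(x)\in L^2([0,+\infty);\mathcal{H})$; (v) $\lim_{t\to+\infty}\big(\dot x(t)+\lambda\nabla\Phi(x(t))+\lambda\beta(t)\nabla\Psi(x(t))\big)=0$; (vi) there exists $x_\infty\in S$ such that $x(t)$ converges weakly to $x_\infty$ as $t\to+\infty$.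
   Context: $\nabla$ and $\nabla^2$ denote gradient and Hessian. $\operatorname{argmin}\Psi$ is the set of minimizers of $\Psi$ over $\mathcal{H}$. $\Psi^*(p)=\sup_{x\in\mathcal{H}}\{\langle p,x\rangle-\Psi(x)\}$ is the Fenchel conjugate of $\Psi$ (values in $\mathbb{R}\cup\{+\infty\}$). $\sigma_{\operatorname{argmin}\Psi}(p)=\sup_{x\in\operatorname{argmin}\Psi}\langle p,x\rangle$ is the support function. The normal cone is $N_{\operatorname{argmin}\Psi}(x)=\{p\in\mathcal{H}:\langle p,y-x\rangle\le 0\ \forall y\in\operatorname{argmin}\Psi\}$ for $x\in\operatorname{argmin}\Psi$ and $\emptyset$ otherwise; its range $\operatorname{ran}N_{\operatorname{argmin}\Psi}$ is the set of all $p$ with $p\in N_{\operatorname{argmin}\Psi}(x)$ for some $x\in\operatorname{argmin}\Psi$. Since $\Psi^*\ge\sigma_{\operatorname{argmin}\Psi}$, the integrand in (4) is nonnegative (with values in $[0,+\infty]$ wherever the support function is finite, which is the case for $p\in\operatorname{ran}N_{\operatorname{argmin}\Psi}$). A strong global solution is a function $x:[0,+\infty)\to\mathcal{H}$ such that $x$ and $\dot x$ are locally absolutely continuous (absolutely continuous on each $[0,b]$, $0<b<+\infty$), the initial conditions hold, and the differential equation holds for almost every $t\in[0,+\infty)$. Under the assumptions on $\Phi,\Psi,\beta$, existence and uniqueness of such a solution follow from the Cauchy-Lipschitz-Picard Theorem. *)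

theory Defs
  imports "HOL-Analysis.Analysis"
begin

definition gradient :: "('a::real_inner \<Rightarrow> real) \<Rightarrow> 'a \<Rightarrow> 'a" where
  "gradient f x = (THE D. GDERIV f x :> D)"

text \<open>The Hessian is the Frechet derivative of the gradient, as a bounded linear operator; Lipschitz
  continuity of the Hessian therefore refers to the operator norm.\<close>

definition hessian :: "('a::real_inner \<Rightarrow> real) \<Rightarrow> 'a \<Rightarrow> ('a \<Rightarrow>\<^sub>L 'a)" where
  "hessian f x = (THE H. (gradient f has_derivative blinfun_apply H) (at x))"

text \<open>Frechet differentiability: on a Hilbert space, by Riesz representation, a real function has a
  Frechet derivative at a point iff it has a gradient there.\<close>

definition twice_differentiable :: "('a::real_inner \<Rightarrow> real) \<Rightarrow> bool" where
  "twice_differentiable f \<longleftrightarrow>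
     (\<forall>x. \<exists>D. GDERIV f x :> D) \<and> (\<forall>x. gradient f differentiable (at x))"

lemma gradient_eq:
  assumes "GDERIV f x :> D"
  shows "gradient f x = D"
  unfolding gradient_def
proof (rule the_equality, rule assms)
  fix D' assume "GDERIV f x :> D'"
  with assms have "(\<lambda>h. inner h D') = (\<lambda>h. inner h D)"
    unfolding gderiv_def by (rule has_derivative_unique[rotated])
  then have "inner h D' = inner h D" for h
    by meson
  then show "D' = D"
    by (metis vector_eq_ldot)
qed

lemma hessian_eq:
  assumes "(gradient f has_derivative blinfun_apply H) (at x)"
  shows "hessian f x = H"
  unfolding hessian_def
  by (rule the_equality, rule assms) (metis assms blinfun_apply_inject has_derivative_unique)

lemma twice_differentiableD:
  assumes "twice_differentiable f"
  shows "GDERIV f x :> gradient f x"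
    and "(gradient f has_derivative blinfun_apply (hessian f x)) (at x)"
proof -
  show "GDERIV f x :> gradient f x"
    using assms gradient_eq unfolding twice_differentiable_def by metis
  obtain F where F: "(gradient f has_derivative F) (at x)"
    using assms unfolding twice_differentiable_def differentiable_def by blast
  then have "blinfun_apply (Blinfun F) = F"
    by (intro bounded_linear_Blinfun_apply) (rule has_derivative_bounded_linear)
  with F have "(gradient f has_derivative blinfun_apply (Blinfun F)) (at x)"
    by simp
  then show "(gradient f has_derivative blinfun_apply (hessian f x)) (at x)"
    using hessian_eq by metis
qed

definition argmin_set :: "('a \<Rightarrow> real) \<Rightarrow> 'a set" where
  "argmin_set f = {x. is_arg_min f (\<lambda>_. True) x}"

definition bilevel_solutions :: "('a \<Rightarrow> real) \<Rightarrow> ('a \<Rightarrow> real) \<Rightarrow> 'a set" where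
  "bilevel_solutions \<Phi> \<Psi> = {z \<in> argmin_set \<Psi>. \<forall>y\<in>argmin_set \<Psi>. \<Phi> z \<le> \<Phi> y}"

definition fenchel_conjugate :: "('a::real_inner \<Rightarrow> real) \<Rightarrow> 'a \<Rightarrow> ereal" where
  "fenchel_conjugate f p = (SUP x. ereal (inner p x - f x))"

definition support_function :: "'a::real_inner set \<Rightarrow> 'a \<Rightarrow> ereal" where
  "support_function C p = (SUP x\<in>C. ereal (inner p x))"

definition normal_cone :: "'a::real_inner set \<Rightarrow> 'a \<Rightarrow> 'a set" where
  "normal_cone C x = (if x \<in> C then {p. \<forall>y\<in>C. inner p (y - x) \<le> 0} else {})"

definition ran_normal_cone :: "'a::real_inner set \<Rightarrow> 'a set" where
  "ran_normal_cone C = (\<Union>x. normal_cone C x)"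

definition weakly_tendsto :: "('b \<Rightarrow> 'a::real_inner) \<Rightarrow> 'a \<Rightarrow> 'b filter \<Rightarrow> bool" where
  "weakly_tendsto f l F \<longleftrightarrow> (\<forall>y. ((\<lambda>t. inner (f t) y) \<longlongrightarrow> inner l y) F)"

text \<open>A function on $[0,+\infty)$ is a total function on the reals of which only the values on
  \<open>{0..}\<close> matter. Its derivative is taken within \<open>{0..}\<close>, hence is one-sided at 0.\<close>

definition hl_deriv :: "(real \<Rightarrow> 'a::real_normed_vector) \<Rightarrow> real \<Rightarrow> 'a" where
  "hl_deriv f t = vector_derivative f (at t within {0..})"

definition hl_C1 :: "(real \<Rightarrow> 'a::real_normed_vector) \<Rightarrow> bool" where
  "hl_C1 f \<longleftrightarrow> f differentiable_on {0..} \<and> continuous_on {0..} (hl_deriv f)"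

definition abs_continuous_on_interval :: "real \<Rightarrow> real \<Rightarrow> (real \<Rightarrow> 'a::metric_space) \<Rightarrow> bool" where
  "abs_continuous_on_interval a b f \<longleftrightarrow>
     (\<forall>\<epsilon>>0. \<exists>\<delta>>0. \<forall>(n::nat) l r.
        (\<forall>i<n. a \<le> l i \<and> l i \<le> r i \<and> r i \<le> b) \<longrightarrow>
        (\<forall>i<n. \<forall>j<n. i \<noteq> j \<longrightarrow> {l i<..<r i} \<inter> {l j<..<r j} = {}) \<longrightarrow>
        (\<Sum>i<n. r i - l i) < \<delta> \<longrightarrow>
        (\<Sum>i<n. dist (f (l i)) (f (r i))) < \<epsilon>)"

definition hl_locally_abs_continuous :: "(real \<Rightarrow> 'a::metric_space) \<Rightarrow> bool" where
  "hl_locally_abs_continuous f \<longleftrightarrow> (\<forall>b>0. abs_continuous_on_interval 0 b f)"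

text \<open>Bochner square integrability. The library's integral is not used because Borel measurability
  does not imply strong measurability when the space is not separable.\<close>

definition hl_strongly_measurable :: "(real \<Rightarrow> 'a::real_normed_vector) \<Rightarrow> bool" where
  "hl_strongly_measurable f \<longleftrightarrow>
     (\<exists>s. (\<forall>n::nat. simple_function (lebesgue_on {0..}) (s n)) \<and>
          (AE t in lebesgue_on {0..}. (\<lambda>n. s n t) \<longlonglongrightarrow> f t))"

definition hl_L2 :: "(real \<Rightarrow> 'a::real_normed_vector) \<Rightarrow> bool" where
  "hl_L2 f \<longleftrightarrow> hl_strongly_measurable f \<and>
     (\<integral>\<^sup>+ t. ennreal ((norm (f t))\<^sup>2) \<partial>lebesgue_on {0..}) < \<infinity>"

text \<open>Since \<open>\<Psi>\<^sup>* \<ge> \<sigma>\<close>, and \<open>\<sigma>\<close> is finite at \<open>p / \<beta> t\<close> for \<open>p\<close> in the range of the normal cone, the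
  integrand is a well-defined element of $[0,+\infty]$ and \<open>e2ennreal\<close> loses nothing.\<close>

definition penalty_integral :: "('a::real_inner \<Rightarrow> real) \<Rightarrow> (real \<Rightarrow> real) \<Rightarrow> 'a \<Rightarrow> ennreal" where
  "penalty_integral \<Psi> \<beta> p =
     (\<integral>\<^sup>+ t. e2ennreal (ereal (\<beta> t) *
        (fenchel_conjugate \<Psi> (p /\<^sub>R \<beta> t) - support_function (argmin_set \<Psi>) (p /\<^sub>R \<beta> t)))
      \<partial>lebesgue_on {0..})"

text \<open>Absolute continuity of the derivative presupposes that it exists everywhere on \<open>{0..}\<close>;
  the second derivative is only required to exist almost everywhere.\<close>

definition strong_global_solution ::
  "real \<Rightarrow> real \<Rightarrow> ('a::real_inner \<Rightarrow> real) \<Rightarrow> ('a \<Rightarrow> real) \<Rightarrow> (real \<Rightarrow> real) \<Rightarrow> 'a \<Rightarrow> 'a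
     \<Rightarrow> (real \<Rightarrow> 'a) \<Rightarrow> bool" where
  "strong_global_solution \<gamma> lam \<Phi> \<Psi> \<beta> u0 v0 x \<longleftrightarrow>
     hl_locally_abs_continuous x \<and>
     x differentiable_on {0..} \<and>
     hl_locally_abs_continuous (hl_deriv x) \<and>
     x 0 = u0 \<and> hl_deriv x 0 = v0 \<and>
     (AE t in lebesgue_on {0..}.
        hl_deriv x differentiable (at t within {0..}) \<and>
        hl_deriv (hl_deriv x) t + \<gamma> *\<^sub>R hl_deriv x t
          + lam *\<^sub>R blinfun_apply (hessian \<Phi> (x t)) (hl_deriv x t)
          + (lam * \<beta> t) *\<^sub>R blinfun_apply (hessian \<Psi> (x t)) (hl_deriv x t)
          + gradient \<Phi> (x t) + (\<beta> t + lam * hl_deriv \<beta> t) *\<^sub>R gradient \<Psi> (x t) = 0)"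

end

theory Submission
  imports Defs
begin

text \<open>Put \<open>g = \<nabla>\<Phi>(x) + \<beta>\<nabla>\<Psi>(x)\<close> and \<open>v = x' + \<lambda>g\<close>. The Hessian terms of the equation are exactly
  \<open>\<lambda>g'\<close>, so it reads \<open>v' = -\<gamma>x' - g\<close>; the right-hand side is continuous, hence \<open>v\<close> is \<open>C\<^sup>1\<close> although
  \<open>x'\<close> is only absolutely continuous. With \<open>e = \<Phi>(x) + \<beta>\<Psi>(x)\<close> and a solution \<open>z\<close> of the bilevel problem,
  the functions \<open>E = |v|\<^sup>2/2 + (1 + \<lambda>\<gamma>)e\<close> and \<open>F = \<langle>v, x - z\<rangle> + (\<gamma>/2)|x - z|\<^sup>2 - \<lambda>e\<close> satisfy
  \<open>E' = -\<gamma>|x'|\<^sup>2 - \<lambda>|g|\<^sup>2 + (1 + \<lambda>\<gamma>)\<beta>'\<Psi>(x)\<close> and \<open>F' = |x'|\<^sup>2 - \<lambda>\<beta>'\<Psi>(x) - \<langle>g, x - z\<rangle>\<close>.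
  By convexity and the condition on \<open>\<Psi>\<^sup>*\<close> applied to \<open>p = -\<nabla>\<Phi>(z)/(1 - \<theta>)\<close>, the derivative of the coercive
  function \<open>W = E + (2\<gamma>/3)F\<close> is at most an integrable function minus a positive combination of
  \<open>|x'|\<^sup>2\<close>, \<open>|g|\<^sup>2\<close> and \<open>\<beta>\<Psi>(x)\<close>. This gives the integrability claims, boundedness of \<open>x\<close> and convergence
  of \<open>E\<close> and \<open>F\<close>; since \<open>|v|\<^sup>2\<close> is integrable and its derivative has an integrable upper bound, \<open>v\<close> tends to 0, so
  \<open>e\<close> and \<open>|x - z|\<close> converge. Integrating the bound on \<open>F'\<close> shows \<open>lim e \<le> \<Phi>(z)\<close>, and Opial's argument
  finishes the proof.\<close>

section \<open>Absolutely continuous curves\<close>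

text \<open>The family of intervals enters through meta-level premises, so that its three conditions
  can be discharged one at a time.\<close>

lemma abs_continuousE:
  assumes "abs_continuous_on_interval a b f" and "\<epsilon> > 0"
  obtains \<delta> where "\<delta> > 0" and "\<And>(n::nat) l r.
        \<lbrakk>\<And>i. i < n \<Longrightarrow> a \<le> l i \<and> l i \<le> r i \<and> r i \<le> b;
         \<And>i j. \<lbrakk>i < n; j < n; i \<noteq> j\<rbrakk> \<Longrightarrow> {l i<..<r i} \<inter> {l j<..<r j} = {};
         (\<Sum>i<n. r i - l i) < \<delta>\<rbrakk> \<Longrightarrow> (\<Sum>i<n. dist (f (l i)) (f (r i))) < \<epsilon>"
proof -
  obtain \<delta> where "\<delta> > 0" and \<delta>: "\<forall>(n::nat) l r.
        (\<forall>i<n. a \<le> l i \<and> l i \<le> r i \<and> r i \<le> b) \<longrightarrow>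
        (\<forall>i<n. \<forall>j<n. i \<noteq> j \<longrightarrow> {l i<..<r i} \<inter> {l j<..<r j} = {}) \<longrightarrow>
        (\<Sum>i<n. r i - l i) < \<delta> \<longrightarrow>
        (\<Sum>i<n. dist (f (l i)) (f (r i))) < \<epsilon>"
    using assms(1)[unfolded abs_continuous_on_interval_def, rule_format, OF assms(2)]
    by (elim exE conjE) (rule that)
  show thesis
    by (rule that[OF \<open>\<delta> > 0\<close>]) (rule \<delta>[rule_format], auto)
qed

text \<open>Mean value inequality with a null exceptional set. A fine tagged division telescopes
  \<open>f b - f a\<close>: intervals tagged outside \<open>N\<close> obey the derivative bound,
  while those tagged in \<open>N\<close> lie in an open set of small measure, where absolute
  continuity makes their total contribution small. No integral of the derivative is formed, so
  values in any normed space are allowed.\<close>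

lemma abs_continuous_derivative_bound_ae:
  fixes f :: "real \<Rightarrow> 'a::real_normed_vector"
  assumes ab: "a \<le> b" and ac: "abs_continuous_on_interval a b f" and N: "negligible N"
    and deriv: "\<And>t. t \<in> {a..b} - N \<Longrightarrow> (f has_vector_derivative f' t) (at t within {a..b})"
    and bnd: "\<And>t. t \<in> {a..b} - N \<Longrightarrow> norm (f' t) \<le> B" and B: "B \<ge> 0"
  shows "norm (f b - f a) \<le> B * (b - a)"
proof -
  have small: "norm (f b - f a) \<le> B * (b - a) + \<epsilon> * (1 + (b - a))" if \<epsilon>: "\<epsilon> > 0" for \<epsilon>
  proof -
    obtain \<delta> where \<delta>: "\<delta> > 0" and ac\<delta>: "\<And>(n::nat) l r.
        \<lbrakk>\<And>i. i < n \<Longrightarrow> a \<le> l i \<and> l i \<le> r i \<and> r i \<le> b;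
         \<And>i j. \<lbrakk>i < n; j < n; i \<noteq> j\<rbrakk> \<Longrightarrow> {l i<..<r i} \<inter> {l j<..<r j} = {};
         (\<Sum>i<n. r i - l i) < \<delta>\<rbrakk> \<Longrightarrow> (\<Sum>i<n. dist (f (l i)) (f (r i))) < \<epsilon>"
      by (fact abs_continuousE[OF ac \<epsilon>])
    have Nnull: "N \<in> null_sets lebesgue"
      using N negligible_iff_null_sets by blast
    \<comment> \<open>The exceptional set is covered by an open set whose measure stays below the
      \<delta> of absolute continuity.\<close>
    obtain U where U: "open U" "N \<subseteq> U" "(U - N) \<in> lmeasurable" "emeasure lebesgue (U - N) < ennreal \<delta>"
      using sets_lebesgue_outer_open[OF _ \<delta>, of N] Nnull by blast
    have Usets: "U \<in> sets lebesgue"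
      using U(1) by simp
    have Uem: "emeasure lebesgue U < ennreal \<delta>"
      using U(4) emeasure_Diff_null_set[OF Nnull Usets] by simp
    have Ulm: "U \<in> lmeasurable"
      using Usets Uem by (intro fmeasurableI) (auto simp: less_top[symmetric] dest: order.strict_trans)
    have Um: "measure lebesgue U < \<delta>"
      using Uem \<delta> by (simp add: emeasure_eq_measure2[OF Ulm] ennreal_less_iff)
    have "\<exists>d>0. \<forall>y\<in>{a..b}. norm (y - t) < d \<longrightarrow> norm (f y - f t) \<le> (B + \<epsilon>) * norm (y - t)"
      if t: "t \<in> {a..b} - N" for t
    proof -
      obtain d where "d > 0" and d: "\<And>y. \<lbrakk>y \<in> {a..b}; norm (y - t) < d\<rbrakk> \<Longrightarrow>
          norm (f y - f t - (y - t) *\<^sub>R f' t) \<le> \<epsilon> * norm (y - t)"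
        using deriv[OF t] \<epsilon> unfolding has_vector_derivative_def has_derivative_within_alt by blast
      have "norm (f y - f t) \<le> (B + \<epsilon>) * norm (y - t)" if y: "y \<in> {a..b}" "norm (y - t) < d" for y
      proof -
        have "norm (f y - f t) \<le> norm (f y - f t - (y - t) *\<^sub>R f' t) + norm ((y - t) *\<^sub>R f' t)"
          using norm_triangle_ineq[of "f y - f t - (y - t) *\<^sub>R f' t" "(y - t) *\<^sub>R f' t"] by simp
        also have "norm ((y - t) *\<^sub>R f' t) \<le> norm (y - t) * B"
          using bnd[OF t] by (simp add: mult_left_mono)
        finally show ?thesis
          using d[OF y] by (simp add: algebra_simps)
      qed
      then show ?thesis using \<open>d > 0\<close> by blast
    qed
    then obtain d where d: "\<And>t. t \<in> {a..b} - N \<Longrightarrow> d t > 0"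
      "\<And>t y. \<lbrakk>t \<in> {a..b} - N; y \<in> {a..b}; norm (y - t) < d t\<rbrakk> \<Longrightarrow> norm (f y - f t) \<le> (B + \<epsilon>) * norm (y - t)"
      by metis
    \<comment> \<open>Tags in \<open>N\<close> get the open cover, the other tags in
      \<open>{a..b}\<close> the ball on which difference quotients are controlled; the last case
      only makes \<open>g\<close> a gauge on the whole line.\<close>
    define g where "g t = (if t \<in> N then U else if t \<in> {a..b} then ball t (d t) else UNIV)" for t
    have "gauge g"
      unfolding gauge_def g_def using U d(1) by auto
    then obtain p where p: "p tagged_division_of {a..b}" "g fine p"
      by (rule fine_division_exists_real)
    have fin: "finite p"
      using p(1) by blast
    have pK: "K = {Inf K..Sup K} \<and> a \<le> Inf K \<and> Inf K \<le> t \<and> t \<le> Sup K \<and> Sup K \<le> b" 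
      if tK: "(t, K) \<in> p" for t K
    proof -
      obtain u w where K: "K = {u..w}"
        using tagged_division_ofD(4)[OF p(1) tK] by auto
      moreover have "t \<in> K" "K \<subseteq> {a..b}"
        using tagged_division_ofD(2,3)[OF p(1) tK] by auto
      ultimately show ?thesis by auto
    qed
    define q where "q = {z \<in> p. fst z \<in> N}"
    have finq: "finite q" and qp: "q \<subseteq> p"
      using fin by (auto simp: q_def)
    \<comment> \<open>Absolute continuity speaks of families indexed by numbers, so the finitely
      many intervals tagged in \<open>N\<close> are enumerated.\<close>
    obtain e where e: "bij_betw e {..<card q} q"
      using ex_bij_betw_nat_finite[OF finq] by (auto simp: atLeast0LessThan)
    define l r where "l i = Inf (snd (e i))" and "r i = Sup (snd (e i))" for i
    have eq: "e i \<in> q" if "i < card q" for i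
      using e that bij_betwE by blast
    have lr: "a \<le> l i \<and> l i \<le> r i \<and> r i \<le> b" if "i < card q" for i
      using eq[OF that] pK[of "fst (e i)" "snd (e i)"] qp unfolding l_def r_def by fastforce
    have disj: "{l i<..<r i} \<inter> {l j<..<r j} = {}" if "i < card q" "j < card q" "i \<noteq> j" for i j
    proof -
      have "e i \<noteq> e j"
        using e that by (auto simp: bij_betw_def inj_on_def)
      moreover have "e i \<in> p" "e j \<in> p"
        using eq that qp by auto
      ultimately have "interior (snd (e i)) \<inter> interior (snd (e j)) = {}"
        using tagged_division_ofD(5)[OF p(1)] by (metis prod.collapse)
      moreover have "interior (snd (e i)) = {l i<..<r i}" "interior (snd (e j)) = {l j<..<r j}"
        using pK[of "fst (e i)" "snd (e i)"] pK[of "fst (e j)" "snd (e j)"] \<open>e i \<in> p\<close> \<open>e j \<in> p\<close>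
        unfolding l_def r_def by (metis interior_atLeastAtMost_real prod.collapse)+
      ultimately show ?thesis by simp
    qed
    have sub: "{l i<..<r i} \<subseteq> U" if "i < card q" for i
    proof -
      have "e i \<in> p" "fst (e i) \<in> N"
        using eq[OF that] by (auto simp: q_def)
      then have "snd (e i) \<subseteq> U"
        using fineD[OF p(2), of "fst (e i)" "snd (e i)"] by (simp add: g_def)
      moreover have "snd (e i) = {l i..r i}"
        using conjunct1[OF pK[of "fst (e i)" "snd (e i)"]] \<open>e i \<in> p\<close>
        unfolding l_def r_def prod.collapse by blast
      ultimately show ?thesis by auto
    qed
    have "(\<Sum>i<card q. r i - l i) = (\<Sum>i<card q. measure lebesgue {l i<..<r i})"
      by (rule sum.cong) (use lr in auto)
    also have "\<dots> = measure lebesgue (\<Union>i<card q. {l i<..<r i})"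
      by (rule measure_finite_Union[symmetric])
         (use disj lr in \<open>auto simp: disjoint_family_on_def emeasure_lborel_Ioo\<close>)
    also have "\<dots> \<le> measure lebesgue U"
      by (rule measure_mono_fmeasurable) (use sub Ulm in auto)
    finally have "(\<Sum>i<card q. r i - l i) < \<delta>"
      using Um by simp
    then have "(\<Sum>i<card q. dist (f (l i)) (f (r i))) < \<epsilon>"
      by (intro ac\<delta> lr disj)
    also have "(\<Sum>i<card q. dist (f (l i)) (f (r i))) = (\<Sum>z\<in>q. dist (f (Inf (snd z))) (f (Sup (snd z))))"
      unfolding l_def r_def by (rule sum.reindex_bij_betw[OF e])
    finally have bad: "(\<Sum>z\<in>q. norm (f (Sup (snd z)) - f (Inf (snd z)))) < \<epsilon>"
      by (simp add: dist_norm norm_minus_commute)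
    have "(\<Sum>z\<in>p - q. norm (f (Sup (snd z)) - f (Inf (snd z)))) \<le> (\<Sum>z\<in>p - q. (B + \<epsilon>) * (Sup (snd z) - Inf (snd z)))"
    proof (rule sum_mono)
      fix z assume z: "z \<in> p - q"
      obtain t K where tK: "z = (t, K)" by fastforce
      have tKp: "(t, K) \<in> p" "t \<notin> N"
        using z tK by (auto simp: q_def)
      note b = pK[OF tKp(1)]
      have tab: "t \<in> {a..b} - N" using b tKp by auto
      have "K \<subseteq> ball t (d t)"
        using p(2) tKp tab unfolding fine_def g_def by fastforce
      moreover have "Inf K \<in> K" "Sup K \<in> K"
        using b by (metis atLeastAtMost_iff order_trans order_refl)+
      ultimately have "norm (Inf K - t) < d t" "norm (Sup K - t) < d t"
        by (auto simp: dist_norm norm_minus_commute)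
      then have "norm (f (Inf K) - f t) \<le> (B + \<epsilon>) * (t - Inf K)" "norm (f (Sup K) - f t) \<le> (B + \<epsilon>) * (Sup K - t)"
        using d(2)[OF tab, of "Inf K"] d(2)[OF tab, of "Sup K"] b by auto
      moreover have "norm (f (Sup K) - f (Inf K)) \<le> norm (f (Inf K) - f t) + norm (f (Sup K) - f t)"
        using norm_triangle_ineq4[of "f (Sup K) - f t" "f (Inf K) - f t"] by simp
      ultimately show "norm (f (Sup (snd z)) - f (Inf (snd z))) \<le> (B + \<epsilon>) * (Sup (snd z) - Inf (snd z))"
        unfolding tK by (simp add: algebra_simps)
    qed
    \<comment> \<open>The added terms are nonnegative, and over the whole division the lengths
      telescope to \<open>b - a\<close>.\<close>
    also have "\<dots> \<le> (\<Sum>z\<in>p. (B + \<epsilon>) * (Sup (snd z) - Inf (snd z)))"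
      by (rule sum_mono2) (use fin \<epsilon> B pK in fastforce)+
    also have "\<dots> = (B + \<epsilon>) * (b - a)"
      using additive_tagged_division_1[OF ab p(1), of "\<lambda>x. x"]
      by (simp add: sum_distrib_left[symmetric] split_beta)
    finally have good: "(\<Sum>z\<in>p - q. norm (f (Sup (snd z)) - f (Inf (snd z)))) \<le> (B + \<epsilon>) * (b - a)" .
    have "f b - f a = (\<Sum>z\<in>p. f (Sup (snd z)) - f (Inf (snd z)))"
      using additive_tagged_division_1[OF ab p(1), of f] by (simp add: split_beta)
    then have "norm (f b - f a) \<le> (\<Sum>z\<in>p. norm (f (Sup (snd z)) - f (Inf (snd z))))"
      by (simp add: norm_sum)
    also have "\<dots> = (\<Sum>z\<in>p - q. norm (f (Sup (snd z)) - f (Inf (snd z)))) + (\<Sum>z\<in>q. norm (f (Sup (snd z)) - f (Inf (snd z))))"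
      by (rule sum.subset_diff[OF qp fin])
    finally show ?thesis
      using good bad by (simp add: algebra_simps)
  qed
  \<comment> \<open>The divisor \<open>1 + (b - a)\<close> is positive even for \<open>a = b\<close>
    and turns the error into an arbitrary \<open>\<eta>\<close>.\<close>
  have "norm (f b - f a) \<le> B * (b - a) + \<eta>" if "\<eta> > 0" for \<eta>
    using small[of "\<eta> / (1 + (b - a))"] that ab by simp
  then show ?thesis
    by (rule field_le_epsilon)
qed

lemma abs_continuous_add_lipschitz:
  fixes f g :: "real \<Rightarrow> 'a::real_normed_vector"
  assumes f: "abs_continuous_on_interval a b f" and g: "L-lipschitz_on {a..b} g"
  shows "abs_continuous_on_interval a b (\<lambda>t. f t + g t)"
  unfolding abs_continuous_on_interval_def
proof (intro allI impI)
  fix \<epsilon> :: real assume \<epsilon>: "\<epsilon> > 0"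
  have L: "L \<ge> 0" using g by (rule lipschitz_on_nonneg)
  obtain \<delta> where \<delta>: "\<delta> > 0" and ac: "\<And>(n::nat) l r.
        \<lbrakk>\<And>i. i < n \<Longrightarrow> a \<le> l i \<and> l i \<le> r i \<and> r i \<le> b;
         \<And>i j. \<lbrakk>i < n; j < n; i \<noteq> j\<rbrakk> \<Longrightarrow> {l i<..<r i} \<inter> {l j<..<r j} = {};
         (\<Sum>i<n. r i - l i) < \<delta>\<rbrakk> \<Longrightarrow> (\<Sum>i<n. dist (f (l i)) (f (r i))) < \<epsilon> / 2"
    by (fact abs_continuousE[OF f half_gt_zero[OF \<epsilon>]])
  \<comment> \<open>The first entry serves \<open>f\<close>, the second keeps the Lipschitz part at
    most \<open>\<epsilon> / 2\<close>; \<open>L + 1\<close> avoids a division by zero.\<close>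
  define \<eta> where "\<eta> = min \<delta> (\<epsilon> / (2 * (L + 1)))"
  have "\<eta> > 0"
    using \<delta> \<epsilon> L by (simp add: \<eta>_def)
  have main: "(\<Sum>i<n. dist (f (l i) + g (l i)) (f (r i) + g (r i))) < \<epsilon>"
    if "\<And>i. i < n \<Longrightarrow> a \<le> l i \<and> l i \<le> r i \<and> r i \<le> b"
      "\<And>i j. \<lbrakk>i < n; j < n; i \<noteq> j\<rbrakk> \<Longrightarrow> {l i<..<r i} \<inter> {l j<..<r j} = {}"
      "(\<Sum>i<n. r i - l i) < \<eta>"
    for n :: nat and l r
  proof -
    have "(\<Sum>i<n. dist (f (l i) + g (l i)) (f (r i) + g (r i)))
        \<le> (\<Sum>i<n. dist (f (l i)) (f (r i)) + L * (r i - l i))"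
    proof (rule sum_mono)
      fix i assume "i \<in> {..<n}"
      then have "l i \<in> {a..b}" "r i \<in> {a..b}" "l i \<le> r i"
        using that(1)[of i] by force+
      then have "dist (g (l i)) (g (r i)) \<le> L * (r i - l i)"
        using lipschitz_onD[OF g, of "l i" "r i"] by (simp add: dist_real_def)
      then show "dist (f (l i) + g (l i)) (f (r i) + g (r i)) \<le> dist (f (l i)) (f (r i)) + L * (r i - l i)"
        using dist_triangle_add[of "f (l i)" "g (l i)" "f (r i)" "g (r i)"] by simp
    qed
    also have "\<dots> = (\<Sum>i<n. dist (f (l i)) (f (r i))) + L * (\<Sum>i<n. r i - l i)"
      by (simp add: sum.distrib sum_distrib_left)
    also have "\<dots> < \<epsilon> / 2 + L * (\<epsilon> / (2 * (L + 1)))"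
    proof (rule add_less_le_mono)
      show "(\<Sum>i<n. dist (f (l i)) (f (r i))) < \<epsilon> / 2"
        by (rule ac) (use that in \<open>auto simp: \<eta>_def\<close>)
      show "L * (\<Sum>i<n. r i - l i) \<le> L * (\<epsilon> / (2 * (L + 1)))"
        using L that(3) by (intro mult_left_mono) (auto simp: \<eta>_def)
    qed
    also have "\<dots> \<le> \<epsilon>"
      using L \<epsilon> by (simp add: field_simps)
    finally show ?thesis .
  qed
  show "\<exists>\<delta>>0. \<forall>(n::nat) l r. (\<forall>i<n. a \<le> l i \<and> l i \<le> r i \<and> r i \<le> b) \<longrightarrow>
        (\<forall>i<n. \<forall>j<n. i \<noteq> j \<longrightarrow> {l i<..<r i} \<inter> {l j<..<r j} = {}) \<longrightarrow>
        (\<Sum>i<n. r i - l i) < \<delta> \<longrightarrow>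
        (\<Sum>i<n. dist (f (l i) + g (l i)) (f (r i) + g (r i))) < \<epsilon>"
    using \<open>\<eta> > 0\<close> by (intro exI[of _ \<eta>] conjI allI impI, assumption) (rule main, auto)
qed

lemma continuous_derivative_imp_lipschitz_on:
  fixes f :: "real \<Rightarrow> 'a::real_normed_vector"
  assumes "\<And>t. t \<in> {a..b} \<Longrightarrow> (f has_vector_derivative f' t) (at t within {a..b})"
    and "continuous_on {a..b} f'"
  obtains L where "L-lipschitz_on {a..b} f"
proof -
  have "bounded (f' ` {a..b})"
    using assms(2) compact_Icc compact_continuous_image compact_imp_bounded by blast
  then obtain B where B: "B > 0" "\<And>t. t \<in> {a..b} \<Longrightarrow> norm (f' t) \<le> B"
    unfolding bounded_pos by auto
  have "B-lipschitz_on {a..b} f"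
  proof (rule bounded_derivative_imp_lipschitz[OF _ convex_real_interval(5)])
    show "(f has_derivative (\<lambda>h. h *\<^sub>R f' t)) (at t within {a..b})" if "t \<in> {a..b}" for t
      using assms(1)[OF that] by (simp add: has_vector_derivative_def)
    show "onorm (\<lambda>h. h *\<^sub>R f' t) \<le> B" if "t \<in> {a..b}" for t
      using B(2)[OF that] by (intro onorm_le) (simp add: mult.commute[of B] mult_left_mono)
    show "0 \<le> B" using B by simp
  qed
  then show thesis by (rule that)
qed

lemma abs_continuous_imp_continuous_on:
  fixes f :: "real \<Rightarrow> 'a::metric_space"
  assumes "abs_continuous_on_interval a b f"
  shows "continuous_on {a..b} f"
  unfolding continuous_on_iff
proof (intro ballI allI impI)
  fix s e :: real assume s: "s \<in> {a..b}" and e: "e > 0"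
  obtain \<delta> where \<delta>: "\<delta> > 0" and ac: "\<And>(n::nat) l r.
        \<lbrakk>\<And>i. i < n \<Longrightarrow> a \<le> l i \<and> l i \<le> r i \<and> r i \<le> b;
         \<And>i j. \<lbrakk>i < n; j < n; i \<noteq> j\<rbrakk> \<Longrightarrow> {l i<..<r i} \<inter> {l j<..<r j} = {};
         (\<Sum>i<n. r i - l i) < \<delta>\<rbrakk> \<Longrightarrow> (\<Sum>i<n. dist (f (l i)) (f (r i))) < e"
    by (fact abs_continuousE[OF assms e])
  have one: "dist (f l) (f r) < e" if "a \<le> l" "l \<le> r" "r \<le> b" "r - l < \<delta>" for l r
    using ac[of "Suc 0" "\<lambda>_. l" "\<lambda>_. r"] that by simp
  show "\<exists>d>0. \<forall>t\<in>{a..b}. dist t s < d \<longrightarrow> dist (f t) (f s) < e"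
  proof (intro exI conjI ballI impI)
    fix t assume t: "t \<in> {a..b}" "dist t s < \<delta>"
    show "dist (f t) (f s) < e"
    proof (cases "t \<le> s")
      case True
      then show ?thesis using one[of t s] s t by (simp add: dist_real_def)
    next
      case False
      then show ?thesis using one[of s t] s t by (simp add: dist_real_def dist_commute)
    qed
  qed (rule \<delta>)
qed

text \<open>Continuity is local: at \<open>t\<close>, the sets \<open>{0..t+1}\<close> and
  \<open>{0..}\<close> define the same filter.\<close>

lemma continuous_on_half_lineI:
  fixes f :: "real \<Rightarrow> 'a::topological_space"
  assumes "\<And>b. b > 0 \<Longrightarrow> continuous_on {0..b} f"
  shows "continuous_on {0..} f"
  unfolding continuous_on_eq_continuous_within
proof
  fix t :: real assume t: "t \<in> {0..}"
  have "at t within {0..t+1} = at t within {0..}"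
    by (rule at_within_nhd[of _ "{..<t+1}"]) (use t in auto)
  moreover have "continuous (at t within {0..t+1}) f"
    using assms[of "t+1"] t by (simp add: continuous_on_eq_continuous_within)
  ultimately show "continuous (at t within {0..}) f"
    by (simp add: continuous_within)
qed

lemma abs_continuous_on_subinterval:
  assumes "abs_continuous_on_interval a b f" "a \<le> a'" "b' \<le> b"
  shows "abs_continuous_on_interval a' b' f"
  unfolding abs_continuous_on_interval_def
proof (intro allI impI)
  fix \<epsilon> :: real assume "\<epsilon> > 0"
  obtain \<delta> where "\<delta> > 0" and \<delta>: "\<And>(n::nat) l r.
        \<lbrakk>\<And>i. i < n \<Longrightarrow> a \<le> l i \<and> l i \<le> r i \<and> r i \<le> b;
         \<And>i j. \<lbrakk>i < n; j < n; i \<noteq> j\<rbrakk> \<Longrightarrow> {l i<..<r i} \<inter> {l j<..<r j} = {};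
         (\<Sum>i<n. r i - l i) < \<delta>\<rbrakk> \<Longrightarrow> (\<Sum>i<n. dist (f (l i)) (f (r i))) < \<epsilon>"
    by (fact abs_continuousE[OF assms(1) \<open>\<epsilon> > 0\<close>])
  show "\<exists>\<delta>>0. \<forall>(n::nat) l r. (\<forall>i<n. a' \<le> l i \<and> l i \<le> r i \<and> r i \<le> b') \<longrightarrow>
        (\<forall>i<n. \<forall>j<n. i \<noteq> j \<longrightarrow> {l i<..<r i} \<inter> {l j<..<r j} = {}) \<longrightarrow>
        (\<Sum>i<n. r i - l i) < \<delta> \<longrightarrow> (\<Sum>i<n. dist (f (l i)) (f (r i))) < \<epsilon>"
    by (intro exI[of _ \<delta>] conjI allI impI, rule \<open>\<delta> > 0\<close>, rule \<delta>) (use assms(2,3) in force)+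
qed

text \<open>An almost-everywhere derivative with a continuous representative is a derivative
  everywhere, by the mean value inequality applied to the sum minus a linear function. Only
  \<open>f\<close> is merely absolutely continuous; \<open>g\<close> is locally Lipschitz, so the
  sum stays absolutely continuous. This will show that the velocity plus \<lambda> times the
  gradient term is \<open>C^1\<close>.\<close>

lemma abs_continuous_ae_derivative_imp_C1:
  fixes f g :: "real \<Rightarrow> 'a::real_normed_vector"
  assumes ac: "hl_locally_abs_continuous f"
    and g: "\<And>t. t \<ge> 0 \<Longrightarrow> (g has_vector_derivative g' t) (at t within {0..})"
    and g': "continuous_on {0..} g'"
    and h: "continuous_on {0..} h"
    and ae: "AE t in lebesgue_on {0..}. ((\<lambda>s. f s + g s) has_vector_derivative h t) (at t within {0..})"
    and t: "t \<ge> 0"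
  shows "((\<lambda>s. f s + g s) has_vector_derivative h t) (at t within {0..})"
proof -
  define N where "N = {t. \<not> (t \<in> {0..} \<longrightarrow> ((\<lambda>s. f s + g s) has_vector_derivative h t) (at t within {0..}))}"
  have "AE t in lebesgue. t \<in> {0..} \<longrightarrow> ((\<lambda>s. f s + g s) has_vector_derivative h t) (at t within {0..})"
    using ae by (subst (asm) AE_restrict_space_iff) auto
  then have N: "negligible N"
    unfolding N_def negligible_iff_null_sets completion.AE_iff_null_sets by simp
  \<comment> \<open>Subtracting the candidate linearization at \<open>t\<close> leaves the
    almost-everywhere derivative \<open>h s - h t\<close>, which is small near \<open>t\<close> by
    continuity of \<open>h\<close>.\<close>
  define w where "w s = f s + (g s - s *\<^sub>R h t)" for s
  have w_bound: "norm (w b - w a) \<le> \<epsilon> * (b - a)"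
    if ab: "0 \<le> a" "a \<le> b" and \<epsilon>: "\<epsilon> > 0" "\<And>s. s \<in> {a..b} \<Longrightarrow> norm (h s - h t) \<le> \<epsilon>" for a b \<epsilon>
  proof -
    have sub: "{a..b} \<subseteq> {0..}" using ab by auto
    have lin: "((\<lambda>s. s *\<^sub>R h t) has_vector_derivative h t) (at s within S)" for s S
      by (auto intro!: derivative_eq_intros simp: has_vector_derivative_def)
    obtain L where L: "L-lipschitz_on {a..b} (\<lambda>s. g s - s *\<^sub>R h t)"
    proof (rule continuous_derivative_imp_lipschitz_on)
      show "((\<lambda>s. g s - s *\<^sub>R h t) has_vector_derivative g' u - h t) (at u within {a..b})"
        if "u \<in> {a..b}" for u
        using that ab by (intro has_vector_derivative_diff lin has_vector_derivative_within_subset[OF g sub]) auto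
      show "continuous_on {a..b} (\<lambda>u. g' u - h t)"
        using g' by (intro continuous_intros continuous_on_subset[OF _ sub])
    qed
    show ?thesis
    proof (rule abs_continuous_derivative_bound_ae[OF ab(2) _ N])
      have "abs_continuous_on_interval 0 (b + 1) f"
        using ac ab by (simp add: hl_locally_abs_continuous_def)
      then show "abs_continuous_on_interval a b w"
        unfolding w_def using ab L
        by (intro abs_continuous_add_lipschitz) (auto intro: abs_continuous_on_subinterval)
      show "(w has_vector_derivative h s - h t) (at s within {a..b})" if "s \<in> {a..b} - N" for s
      proof -
        have "((\<lambda>s. f s + g s) has_vector_derivative h s) (at s within {0..})"
          using that ab by (auto simp: N_def)
        then have "((\<lambda>s. f s + g s) has_vector_derivative h s) (at s within {a..b})"
          by (rule has_vector_derivative_within_subset[OF _ sub])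
        from has_vector_derivative_diff[OF this lin]
        show ?thesis
          unfolding w_def by (simp add: algebra_simps)
      qed
    qed (use \<epsilon> in auto)
  qed
  show ?thesis
    unfolding has_vector_derivative_def has_derivative_within_alt
  proof (intro conjI allI impI bounded_linear_scaleR_left)
    fix \<epsilon> :: real assume \<epsilon>: "\<epsilon> > 0"
    obtain d where d: "d > 0" "\<And>s. \<lbrakk>s \<in> {0..}; dist s t < d\<rbrakk> \<Longrightarrow> dist (h s) (h t) < \<epsilon>"
      using h t \<epsilon> unfolding continuous_on_iff by (metis atLeast_iff)
    have "norm (f y + g y - (f t + g t) - (y - t) *\<^sub>R h t) \<le> \<epsilon> * norm (y - t)"
      if y: "y \<in> {0..}" "norm (y - t) < d" for y
    proof -
      have eq: "f y + g y - (f t + g t) - (y - t) *\<^sub>R h t = w y - w t"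
        by (simp add: w_def algebra_simps)
      have near: "norm (h s - h t) \<le> \<epsilon>" if "s \<in> {min t y..max t y}" for s
      proof -
        have "s \<in> {0..}" "dist s t < d"
          using that y t by (auto simp: dist_real_def)
        then show ?thesis
          using d(2) by (simp add: dist_norm less_imp_le)
      qed
      show ?thesis
      proof (cases "t \<le> y")
        case True
        then show ?thesis
          unfolding eq using w_bound[OF t True \<epsilon>] near by simp
      next
        case False
        then have "norm (w t - w y) \<le> \<epsilon> * (t - y)"
          using y near by (intro w_bound \<epsilon>) auto
        then show ?thesis
          unfolding eq using False by (simp add: norm_minus_commute)
      qed
    qed
    then show "\<exists>d>0. \<forall>y\<in>{0..}. norm (y - t) < d \<longrightarrow>
        norm (f y + g y - (f t + g t) - (y - t) *\<^sub>R h t) \<le> \<epsilon> * norm (y - t)"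
      using d(1) by blast
  qed
qed

section \<open>Integrals over the half-line\<close>

text \<open>The truncations of \<open>f\<close> to \<open>{0..k}\<close> increase to
  \<open>f\<close> and have bounded integrals, so monotone convergence applies.\<close>

lemma integrable_on_half_lineI:
  fixes f :: "real \<Rightarrow> real"
  assumes cont: "continuous_on {0..} f" and nn: "\<And>t. t \<ge> 0 \<Longrightarrow> f t \<ge> 0"
    and bnd: "\<And>T. T \<ge> 0 \<Longrightarrow> integral {0..T} f \<le> M"
  shows "f integrable_on {0..}"
proof -
  define \<phi> where "\<phi> k t = (if t \<in> {0..real k} then f t else 0)" for k t
  have int: "f integrable_on {0..real k}" for k
    by (intro integrable_continuous_real continuous_on_subset[OF cont]) auto
  have Int: "{0..real k} \<inter> {0..} = {0..real k}" for k
    by auto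
  have eq: "integral {0..} (\<phi> k) = integral {0..real k} f" for k
    unfolding \<phi>_def integral_restrict_Int Int ..
  have "f integrable_on {0..} \<and> (\<lambda>k. integral {0..} (\<phi> k)) \<longlonglongrightarrow> integral {0..} f"
  proof (rule monotone_convergence_increasing)
    show "\<phi> k integrable_on {0..}" for k
      unfolding \<phi>_def integrable_restrict_Int Int by (rule int)
    show "\<phi> k t \<le> \<phi> (Suc k) t" if "t \<in> {0..}" for k t
      using nn that by (auto simp: \<phi>_def)
    show "(\<lambda>k. \<phi> k t) \<longlonglongrightarrow> f t" if "t \<in> {0..}" for t
    proof -
      have "\<forall>\<^sub>F k in sequentially. \<phi> k t = f t"
        using eventually_ge_at_top[of "nat \<lceil>t\<rceil>"] 
        by eventually_elim (use that in \<open>auto simp: \<phi>_def nat_le_iff ceiling_le_iff\<close>)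
      then show ?thesis
        by (rule tendsto_eventually)
    qed
    show "bounded (range (\<lambda>k. integral {0..} (\<phi> k)))"
    proof (rule boundedI)
      fix y assume "y \<in> range (\<lambda>k. integral {0..} (\<phi> k))"
      then obtain k where "y = integral {0..real k} f"
        using eq by auto
      moreover have "integral {0..real k} f \<ge> 0"
        using int nn by (intro integral_nonneg) auto
      ultimately show "norm y \<le> M"
        using bnd[of "real k"] by simp
    qed
  qed
  then show ?thesis by simp
qed

lemma integral_Icc_le_half_line:
  fixes f :: "real \<Rightarrow> real"
  assumes "continuous_on {0..} f" "\<And>t. t \<ge> 0 \<Longrightarrow> f t \<ge> 0" "f integrable_on {0..}"
  shows "integral {0..T} f \<le> integral {0..} f"
  using assms
  by (intro integral_subset_le integrable_continuous_real continuous_on_subset[OF assms(1)]) auto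

lemma integrable_on_half_line_mono:
  fixes f g :: "real \<Rightarrow> real"
  assumes "continuous_on {0..} f" "continuous_on {0..} g"
    and "\<And>t. t \<ge> 0 \<Longrightarrow> 0 \<le> f t" "\<And>t. t \<ge> 0 \<Longrightarrow> f t \<le> g t" and "g integrable_on {0..}"
  shows "f integrable_on {0..}"
proof (rule integrable_on_half_lineI[OF assms(1,3)])
  fix T :: real
  have "integral {0..T} f \<le> integral {0..T} g"
    using assms(4) by (intro integral_le integrable_continuous_real 
      continuous_on_subset[OF assms(1)] continuous_on_subset[OF assms(2)]) auto
  also have "\<dots> \<le> integral {0..} g"
    by (rule integral_Icc_le_half_line[OF assms(2) _ assms(5)]) (use assms(3,4) order_trans in blast)
  finally show "integral {0..T} f \<le> integral {0..} g" .
qed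

lemma nn_integral_lebesgue_on_eq_lborel:
  assumes "S \<in> sets lebesgue"
  shows "(\<integral>\<^sup>+ t. f t \<partial>lebesgue_on S) = (\<integral>\<^sup>+ t. f t * indicator S t \<partial>lborel)"
  using assms by (simp add: nn_integral_restrict_space nn_integral_completion)

lemma nn_integral_half_line_finite:
  fixes f :: "real \<Rightarrow> real"
  assumes "\<And>t. t \<ge> 0 \<Longrightarrow> f t \<ge> 0" "f integrable_on {0..}"
  shows "(\<integral>\<^sup>+ t. ennreal (f t) \<partial>lebesgue_on {0..}) < \<infinity>"
  using nn_integral_has_integral_lebesgue'[of "{0..}" f, OF _ integrable_integral[OF assms(2)]] assms(1)
  by (simp add: nn_integral_lebesgue_on_eq_lborel)

text \<open>The nonnegative integral dominates every truncated gauge integral. This carries the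
  penalty condition, stated as a nonnegative Lebesgue integral, over to the gauge integral used for
  the energy estimates.\<close>

lemma nn_integral_finite_imp_integrable_on_half_line:
  fixes f :: "real \<Rightarrow> real"
  assumes cont: "continuous_on {0..} f" and nn: "\<And>t. t \<ge> 0 \<Longrightarrow> f t \<ge> 0"
    and fin: "(\<integral>\<^sup>+ t. ennreal (f t) \<partial>lebesgue_on {0..}) < \<infinity>"
  shows "f integrable_on {0..}"
proof (rule integrable_on_half_lineI[OF cont nn])
  fix T :: real
  obtain M where M: "M \<ge> 0" "(\<integral>\<^sup>+ t. ennreal (f t) \<partial>lebesgue_on {0..}) = ennreal M"
    using fin by (metis ennreal_cases infinity_ennreal_def less_irrefl)
  have int: "f integrable_on {0..T}"
    by (intro integrable_continuous_real continuous_on_subset[OF cont]) auto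
  have "ennreal (integral {0..T} f) = (\<integral>\<^sup>+ t. ennreal (f t) * indicator {0..T} t \<partial>lborel)"
    using nn by (intro nn_integral_has_integral_lebesgue'[symmetric] integrable_integral[OF int]) auto
  also have "\<dots> \<le> (\<integral>\<^sup>+ t. ennreal (f t) * indicator {0..} t \<partial>lborel)"
    by (intro nn_integral_mono) (auto simp: indicator_def)
  also have "\<dots> = ennreal M"
    using M(2) by (simp add: nn_integral_lebesgue_on_eq_lborel)
  finally show "integral {0..T} f \<le> enn2real (\<integral>\<^sup>+ t. ennreal (f t) \<partial>lebesgue_on {0..})"
    using M by (simp add: ennreal_le_iff)
qed

lemma has_integral_derivative_half_line:
  fixes f :: "real \<Rightarrow> 'a::banach"
  assumes "\<And>t. t \<ge> 0 \<Longrightarrow> (f has_vector_derivative f' t) (at t within {0..})" and "0 \<le> a" "a \<le> b"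
  shows "(f' has_integral f b - f a) {a..b}"
proof (rule fundamental_theorem_of_calculus[OF assms(3)])
  show "(f has_vector_derivative f' t) (at t within {a..b})" if "t \<in> {a..b}" for t
    using that assms(2) by (intro has_vector_derivative_within_subset[OF assms(1)]) auto
qed

text \<open>Integrating the differential inequality bounds the increment of \<open>W\<close> by the
  integral of \<open>D\<close> minus that of \<open>A\<close>. The lower bound on \<open>W\<close>
  then bounds the integral of \<open>A\<close>, and \<open>W\<close> is monotone up to the
  convergent integral of \<open>D\<close>.\<close>

lemma dissipation:
  fixes W :: "real \<Rightarrow> real"
  assumes W: "\<And>t. t \<ge> 0 \<Longrightarrow> (W has_real_derivative W' t) (at t within {0..})"
    and le: "\<And>t. t \<ge> 0 \<Longrightarrow> W' t \<le> D t - A t"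
    and A: "continuous_on {0..} A" "\<And>t. t \<ge> 0 \<Longrightarrow> A t \<ge> 0"
    and D: "continuous_on {0..} D" "\<And>t. t \<ge> 0 \<Longrightarrow> D t \<ge> 0" "D integrable_on {0..}"
    and bnd: "\<And>t. t \<ge> 0 \<Longrightarrow> w \<le> W t"
  shows "A integrable_on {0..}"
    and "\<And>t. t \<ge> 0 \<Longrightarrow> W t \<le> W 0 + integral {0..} D"
    and "\<exists>l. (W \<longlongrightarrow> l) at_top"
proof -
  have intD: "D integrable_on {a..b}" and intA: "A integrable_on {a..b}" if "0 \<le> a" for a b
    using that by (auto intro!: integrable_continuous_real intro: continuous_on_subset[OF D(1)] continuous_on_subset[OF A(1)])
  have step: "W t - W s \<le> integral {s..t} D - integral {s..t} A" if "0 \<le> s" "s \<le> t" for s t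
  proof (rule has_integral_le)
    show "(W' has_integral W t - W s) {s..t}"
      using W that by (intro has_integral_derivative_half_line) (auto simp: has_real_derivative_iff_has_vector_derivative)
    show "((\<lambda>u. D u - A u) has_integral integral {s..t} D - integral {s..t} A) {s..t}"
      by (intro has_integral_diff integrable_integral intD intA that)
  qed (use le that in auto)
  have nnA: "integral {a..b} A \<ge> 0" if "0 \<le> a" for a b
    using A(2) that by (intro integral_nonneg intA) auto
  have nnD: "integral {a..b} D \<ge> 0" if "0 \<le> a" for a b
    using D(2) that by (intro integral_nonneg intD) auto
  show upper: "W t \<le> W 0 + integral {0..} D" if "t \<ge> 0" for t
    using step[of 0 t] that nnA[of 0 t] integral_Icc_le_half_line[OF D(1,2,3), of t] by simp
  show "A integrable_on {0..}"
  proof (rule integrable_on_half_lineI[OF A])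
    show "integral {0..T} A \<le> W 0 + integral {0..} D - w" if "T \<ge> 0" for T
      using step[of 0 T] that bnd[OF that] integral_Icc_le_half_line[OF D(1,2,3), of T] by simp
  qed
  \<comment> \<open>Removing the accumulated error makes \<open>u\<close> nonincreasing; it is
    bounded below because \<open>D\<close> is integrable, so \<open>u\<close> and the integral of
    \<open>D\<close> both converge.\<close>
  define u where "u t = W t - integral {0..t} D" for t
  have split: "integral {0..t} D = integral {0..s} D + integral {s..t} D" if "0 \<le> s" "s \<le> t" for s t
    using that intD[of 0 t] by (simp add: Henstock_Kurzweil_Integration.integral_combine)
  have mono_u: "u t \<le> u s" if "0 \<le> s" "s \<le> t" for s t
    using step[OF that] split[OF that] nnA[of s t] that by (simp add: u_def)
  have mono_I: "integral {0..s} D \<le> integral {0..t} D" if "0 \<le> s" "s \<le> t" for s t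
    using split[OF that] nnD[of s t] that by simp
  have tendsto: "\<exists>l. (f \<longlongrightarrow> l) at_top" if mono: "\<And>s t. \<lbrakk>0 \<le> s; s \<le> t\<rbrakk> \<Longrightarrow> f s \<le> f t" 
      and B: "\<And>t. t \<ge> 0 \<Longrightarrow> f t \<le> B" for f :: "real \<Rightarrow> real" and B
  proof -
    define l where "l = (SUP t\<in>{0..}. f t)"
    have bdd: "bdd_above (f ` {0..})"
      using B by (auto simp: bdd_above_def)
    have "(f \<longlongrightarrow> l) at_top"
    proof (rule increasing_tendsto)
      show "\<forall>\<^sub>F t in at_top. f t \<le> l"
        using eventually_ge_at_top[of 0] by eventually_elim (auto simp: l_def intro!: cSUP_upper bdd)
      fix y assume "y < l"
      then obtain s where s: "s \<ge> 0" "y < f s"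
        using less_cSUP_iff[OF _ bdd] unfolding l_def by auto
      then show "\<forall>\<^sub>F t in at_top. y < f t"
        by (intro eventually_mono[OF eventually_ge_at_top[of s]] less_le_trans[OF s(2) mono[OF s(1)]])
    qed
    then show ?thesis ..
  qed
  obtain l1 where l1: "((\<lambda>t. - u t) \<longlongrightarrow> l1) at_top"
  proof -
    have "- u t \<le> integral {0..} D - w" if "t \<ge> 0" for t
      using bnd[OF that] integral_Icc_le_half_line[OF D(1,2,3), of t] by (simp add: u_def)
    then show thesis
      using tendsto[of "\<lambda>t. - u t"] mono_u that by force
  qed
  obtain l2 where l2: "((\<lambda>t. integral {0..t} D) \<longlongrightarrow> l2) at_top"
    using tendsto[of "\<lambda>t. integral {0..t} D"] mono_I integral_Icc_le_half_line[OF D(1,2,3)] by blast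
  have "((\<lambda>t. integral {0..t} D - - u t) \<longlongrightarrow> l2 - l1) at_top"
    by (rule tendsto_diff[OF l2 l1])
  then show "\<exists>l. (W \<longlongrightarrow> l) at_top"
    by (auto simp: u_def)
qed

text \<open>From some time on \<open>f\<close> exceeds \<open>l / 2\<close>, so the integral grows
  at least linearly.\<close>

lemma integral_positive_limit_unbounded:
  fixes f :: "real \<Rightarrow> real"
  assumes cont: "continuous_on {0..} f" and lim: "(f \<longlongrightarrow> l) at_top" and l: "l > 0"
  shows "\<forall>\<^sub>F T in at_top. integral {0..T} f > M"
proof -
  have "\<forall>\<^sub>F t in at_top. f t > l / 2"
    using order_tendstoD(1)[OF lim, of "l / 2"] l by simp
  then obtain s0 where s0: "\<And>t. t \<ge> s0 \<Longrightarrow> f t > l / 2"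
    unfolding eventually_at_top_linorder by blast
  define s where "s = max 0 s0"
  have s: "s \<ge> 0" by (simp add: s_def)
  have int: "f integrable_on {a..b}" if "0 \<le> a" for a b
    using that by (intro integrable_continuous_real continuous_on_subset[OF cont]) auto
  \<comment> \<open>The length of \<open>{s..T}\<close> times \<open>l / 2\<close> must exceed
    \<open>M\<close> minus the integral up to \<open>s\<close>; the summand 1 makes the inequality
    strict.\<close>
  have "integral {0..T} f > M" if T: "T \<ge> s + max 0 ((M - integral {0..s} f + 1) * 2 / l)" for T
  proof -
    have sT: "s \<le> T" using T by linarith
    have "(M - integral {0..s} f + 1) * 2 / l \<le> T - s"
      using T by linarith
    then have "M + 1 - integral {0..s} f \<le> (T - s) * (l / 2)"
      using l by (simp add: field_simps)
    also have "\<dots> \<le> integral {s..T} f"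
    proof (rule has_integral_le)
      show "((\<lambda>_. l / 2) has_integral (T - s) * (l / 2)) {s..T}"
        using has_integral_const_real[of "l / 2" s T] sT by simp
      show "(f has_integral integral {s..T} f) {s..T}"
        by (intro integrable_integral int s)
      show "l / 2 \<le> f t" if "t \<in> {s..T}" for t
        using s0[of t] that by (simp add: s_def)
    qed
    finally have "integral {0..s} f + integral {s..T} f > M" by simp
    then show ?thesis
      using s sT int[of 0 T] by (simp add: Henstock_Kurzweil_Integration.integral_combine)
  qed
  then show ?thesis
    unfolding eventually_at_top_linorder by blast
qed

text \<open>The one-sided derivative bound yields a limit through \<open>dissipation\<close> with
  zero dissipation, and a positive limit would contradict integrability.\<close>

lemma integrable_tendsto_zero:
  fixes f :: "real \<Rightarrow> real"
  assumes f: "\<And>t. t \<ge> 0 \<Longrightarrow> (f has_real_derivative f' t) (at t within {0..})"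
    and nn: "\<And>t. t \<ge> 0 \<Longrightarrow> f t \<ge> 0" and int: "f integrable_on {0..}"
    and le: "\<And>t. t \<ge> 0 \<Longrightarrow> f' t \<le> D t"
    and D: "continuous_on {0..} D" "\<And>t. t \<ge> 0 \<Longrightarrow> D t \<ge> 0" "D integrable_on {0..}"
  shows "(f \<longlongrightarrow> 0) at_top"
proof -
  have cont: "continuous_on {0..} f"
    using f by (auto simp: continuous_on_eq_continuous_within intro: DERIV_continuous)
  obtain l where l: "(f \<longlongrightarrow> l) at_top"
    using dissipation(3)[of f f' D "\<lambda>_. 0" 0] assms by auto
  have "l \<ge> 0"
    by (rule tendsto_lowerbound[OF l]) (auto intro: eventually_mono[OF eventually_ge_at_top[of 0]] nn)
  moreover have "\<not> l > 0"
    using eventually_happens[OF integral_positive_limit_unbounded[OF cont l, of "integral {0..} f"]]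
      integral_Icc_le_half_line[OF cont nn int] by (auto simp: not_less[symmetric])
  ultimately show ?thesis using l by simp
qed

section \<open>Strong measurability and square integrability on the half-line\<close>

lemma continuous_imp_hl_strongly_measurable:
  fixes f :: "real \<Rightarrow> 'a::real_normed_vector"
  assumes "continuous_on {0..} f"
  shows "hl_strongly_measurable f"
proof -
  \<comment> \<open>Time is rounded down to the grid of mesh \<open>1 / (n + 1)\<close> and sent to
    0 from \<open>n\<close> on. Thus \<open>g n\<close> takes finitely many values on the half-line,
    and \<open>f\<close> composed with \<open>g n\<close> is simple.\<close>
  define g where "g n t = (if t < real n then of_int \<lfloor>real (Suc n) * t\<rfloor> / real (Suc n) else 0)" for n t
  have lim: "(\<lambda>n. g n t) \<longlonglongrightarrow> t" if "t \<ge> 0" for t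
  proof (rule Lim_transform_eventually)
    have bound: "\<bar>of_int \<lfloor>real (Suc n) * t\<rfloor> / real (Suc n) - t\<bar> \<le> inverse (real (Suc n))" for n
    proof -
      have "\<bar>of_int \<lfloor>real (Suc n) * t\<rfloor> - real (Suc n) * t\<bar> \<le> 1"
        by linarith
      moreover have "of_int \<lfloor>real (Suc n) * t\<rfloor> / real (Suc n) - t
          = (of_int \<lfloor>real (Suc n) * t\<rfloor> - real (Suc n) * t) / real (Suc n)"
        by (simp add: field_simps)
      ultimately show ?thesis
        by (simp add: abs_div divide_right_mono inverse_eq_divide)
    qed
    show "(\<lambda>n. of_int \<lfloor>real (Suc n) * t\<rfloor> / real (Suc n)) \<longlonglongrightarrow> t"
      by (rule LIM_zero_cancel, rule Lim_null_comparison[OF _ LIMSEQ_inverse_real_of_nat])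
         (simp only: real_norm_def bound always_eventually simp_thms)
    show "\<forall>\<^sub>F n in sequentially. of_int \<lfloor>real (Suc n) * t\<rfloor> / real (Suc n) = g n t"
      using eventually_gt_at_top[of "nat \<lceil>t\<rceil>"]
    proof eventually_elim
      case (elim n)
      then have "t < real n" by linarith
      then show ?case by (simp add: g_def)
    qed
  qed
  show ?thesis
    unfolding hl_strongly_measurable_def
  proof (intro exI conjI allI)
    fix n :: nat
    have "simple_function (lebesgue_on {0..}) (g n)"
    proof (rule simple_function_borel_measurable)
      show "g n \<in> borel_measurable (lebesgue_on {0..})"
        unfolding g_def by (intro measurable_restrict_space1 measurable_completion) measurable
      have "g n t \<in> (\<lambda>k. of_int k / real (Suc n)) ` {0..\<lfloor>real (Suc n) * real n\<rfloor>}" if "t \<ge> 0" for t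
      proof (cases "t < real n")
        case True
        have "real (Suc n) * t \<le> real (Suc n) * real n"
          using True by (intro mult_left_mono) auto
        then have "\<lfloor>real (Suc n) * t\<rfloor> \<in> {0..\<lfloor>real (Suc n) * real n\<rfloor>}"
          using that by (simp only: atLeastAtMost_iff floor_mono) (simp add: that)
        then show ?thesis
          using True unfolding g_def by (intro image_eqI) auto
      next
        case False
        then show ?thesis 
          unfolding g_def by (intro image_eqI[of _ _ 0]) auto
      qed
      then have "g n ` {0..} \<subseteq> (\<lambda>k. of_int k / real (Suc n)) ` {0..\<lfloor>real (Suc n) * real n\<rfloor>}"
        by (intro image_subsetI) simp
      then show "finite (g n ` space (lebesgue_on {0..}))"
        by (auto intro: finite_subset)
    qed
    then show "simple_function (lebesgue_on {0..}) (f \<circ> g n)"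
      by (rule simple_function_compose)
  next
    have "(\<lambda>n. f (g n t)) \<longlonglongrightarrow> f t" if "t \<ge> 0" for t
    proof (rule continuous_on_tendsto_compose[OF assms lim[OF that]])
      have "g n t \<ge> 0" for n
        using that by (simp add: g_def)
      then show "\<forall>\<^sub>F n in sequentially. g n t \<in> {0..}"
        by simp
    qed (use that in simp)
    then show "AE t in lebesgue_on {0..}. (\<lambda>n. (f \<circ> g n) t) \<longlonglongrightarrow> f t"
      by (intro AE_I2) simp
  qed
qed

lemma hl_L2I:
  fixes f :: "real \<Rightarrow> 'a::real_normed_vector"
  assumes "continuous_on {0..} f" "(\<lambda>t. (norm (f t))\<^sup>2) integrable_on {0..}"
  shows "hl_L2 f"
  using assms unfolding hl_L2_def
  by (auto intro: continuous_imp_hl_strongly_measurable nn_integral_half_line_finite[simplified])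

section \<open>Convexity and weak convergence in Hilbert spaces\<close>

text \<open>Points of nearly minimal norm in \<open>K n\<close> form a Cauchy sequence by the
  parallelogram identity, and completeness supplies a common point. This is the only compactness
  argument used for weak convergence.\<close>

lemma nested_bounded_closed_convex_nonempty_Inter:
  fixes K :: "nat \<Rightarrow> 'a::{real_inner, complete_space} set"
  assumes cl: "\<And>n. closed (K n)" and cv: "\<And>n. convex (K n)" and ne: "\<And>n. K n \<noteq> {}"
    and dec: "\<And>m n. m \<le> n \<Longrightarrow> K n \<subseteq> K m" and bnd: "bounded (K 0)"
  shows "(\<Inter>n. K n) \<noteq> {}"
proof -
  obtain B where B: "\<And>y. y \<in> K 0 \<Longrightarrow> norm y \<le> B"
    using bnd unfolding bounded_iff by blast
  define d where "d n = (INF y\<in>K n. norm y)" for n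
  have bdd: "bdd_below (norm ` K n)" for n
    by (auto simp: bdd_below_def intro: norm_ge_zero)
  have d_le: "d n \<le> norm y" if "y \<in> K n" for n y
    unfolding d_def by (rule cINF_lower[OF bdd that])
  have d_nonneg: "0 \<le> d n" for n
    unfolding d_def by (rule cINF_greatest[OF ne]) simp
  have "\<exists>y\<in>K n. norm y < d n + inverse (real (Suc n))" for n
    using cINF_less_iff[OF ne bdd, of n "d n + inverse (real (Suc n))"] by (simp add: d_def)
  then obtain y where y: "\<And>n. y n \<in> K n" "\<And>n. norm (y n) < d n + inverse (real (Suc n))"
    by metis
  have yK: "y m \<in> K n" if "n \<le> m" for n m
    using y(1)[of m] dec[OF that] by blast
  have "incseq d"
    unfolding incseq_def d_def
    by (intro allI impI cINF_superset_mono ne bdd dec) simp_all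
  moreover have "d n \<le> B" for n
    using d_le[OF y(1), of n] B[OF yK[of 0 n]] by simp
  ultimately obtain D where D: "d \<longlonglongrightarrow> D"
    using incseq_convergent[of d B] by blast
  have "(\<lambda>n. norm (y n)) \<longlonglongrightarrow> D"
  proof (rule tendsto_sandwich[where f = d])
    show "(\<lambda>n. d n + inverse (real (Suc n))) \<longlonglongrightarrow> D"
      using tendsto_add[OF D LIMSEQ_inverse_real_of_nat] by simp
    show "\<forall>\<^sub>F n in sequentially. norm (y n) \<le> d n + inverse (real (Suc n))"
      using y(2) by (intro always_eventually allI less_imp_le)
  qed (use D d_le y(1) in auto)
  then have lim_y: "(\<lambda>n. (norm (y n))\<^sup>2) \<longlonglongrightarrow> D\<^sup>2"
    by (rule tendsto_power)
  have lim_d: "(\<lambda>n. (d n)\<^sup>2) \<longlonglongrightarrow> D\<^sup>2"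
    using D by (rule tendsto_power)
  \<comment> \<open>The midpoint of \<open>y n\<close> and \<open>y m\<close> lies in the convex set
    \<open>K n\<close>, so its norm is at least \<open>d n\<close>.\<close>
  have dist_y: "(norm (y n - y m))\<^sup>2 \<le> 2 * (norm (y n))\<^sup>2 + 2 * (norm (y m))\<^sup>2 - 4 * (d n)\<^sup>2" 
    if "n \<le> m" for n m
  proof -
    have "(1/2) *\<^sub>R y n + (1/2) *\<^sub>R y m \<in> K n"
      using cv[of n] y(1)[of n] yK[OF that] by (intro convexD) auto
    then have "d n \<le> norm ((1/2) *\<^sub>R (y n + y m))"
      using d_le by (simp add: scaleR_add_right)
    then have "2 * d n \<le> norm (y n + y m)"
      by simp
    then have "(2 * d n)\<^sup>2 \<le> (norm (y n + y m))\<^sup>2"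
      using d_nonneg by (intro power_mono) auto
    then show ?thesis
      by (simp add: power2_norm_eq_inner inner_simps power_mult_distrib inner_commute)
  qed
  have "Cauchy y"
  proof (rule CauchyI)
    fix e :: real assume e: "e > 0"
    \<comment> \<open>In \<open>dist_y\<close> the multiples of the squared limit \<open>D\<close>
      cancel and the errors add up to at most eight times \<open>e^2 / 16\<close>, which is below
      \<open>e^2\<close>.\<close>
    then have e16: "e\<^sup>2 / 16 > 0" by simp
    from LIMSEQ_D[OF lim_y e16] LIMSEQ_D[OF lim_d e16]
    obtain M1 M2 where M1: "\<And>n. n \<ge> M1 \<Longrightarrow> \<bar>(norm (y n))\<^sup>2 - D\<^sup>2\<bar> < e\<^sup>2 / 16"
      and M2: "\<And>n. n \<ge> M2 \<Longrightarrow> \<bar>(d n)\<^sup>2 - D\<^sup>2\<bar> < e\<^sup>2 / 16"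
      by auto
    have close: "norm (y n - y m) < e" if "n \<ge> max M1 M2" "n \<le> m" for n m
    proof -
      have "(norm (y n - y m))\<^sup>2 < e\<^sup>2"
        using dist_y[OF that(2)] M1[of n] M1[of m] M2[of n] that e16 by linarith
      then show ?thesis
        using e by (simp add: power2_less_imp_less)
    qed
    show "\<exists>M. \<forall>m\<ge>M. \<forall>n\<ge>M. norm (y m - y n) < e"
      using close by (metis nle_le norm_minus_commute)
  qed
  then obtain l where l: "y \<longlonglongrightarrow> l"
    using Cauchy_convergent convergent_def by blast
  have "l \<in> K n" for n
    by (rule Lim_in_closed_set[OF cl _ _ l]) (auto intro: eventually_mono[OF eventually_ge_at_top[of n]] yK)
  then show ?thesis by blast
qed

text \<open>In place of weak sequential compactness: a point lying in every closed convex set that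
  eventually contains the curve (along \<open>P\<close>). It serves as a weak cluster point.\<close>

lemma bounded_closed_convex_cluster_point:
  fixes f :: "real \<Rightarrow> 'a::{real_inner, complete_space}"
  assumes B: "\<forall>t\<ge>0. norm (f t) \<le> B" and P: "\<exists>\<^sub>F t in at_top. P t"
  obtains y where "\<And>C. \<lbrakk>closed C; convex C; \<forall>\<^sub>F t in at_top. P t \<longrightarrow> f t \<in> C\<rbrakk> \<Longrightarrow> y \<in> C"
proof -
  \<comment> \<open>Closed convex hulls of the tails of the curve, restricted to the times
    satisfying \<open>P\<close>.\<close>
  define K where "K n = closure (convex hull (f ` {t. t \<ge> real n \<and> P t}))" for n
  have sub: "f ` {t. t \<ge> real n \<and> P t} \<subseteq> K n" for n
    unfolding K_def by (meson closure_subset hull_subset order_trans)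
  have min: "K n \<subseteq> C" if "closed C" "convex C" "f ` {t. t \<ge> real n \<and> P t} \<subseteq> C" for C n
    unfolding K_def using that by (intro closure_minimal hull_minimal)
  have "(\<Inter>n. K n) \<noteq> {}"
  proof (rule nested_bounded_closed_convex_nonempty_Inter)
    show "closed (K n)" "convex (K n)" for n
      unfolding K_def by (auto intro: convex_closure)
    show "K n \<noteq> {}" for n
    proof -
      have "\<exists>\<^sub>F t in at_top. t \<ge> real n \<and> P t"
        using frequently_eventually_frequently[OF P eventually_ge_at_top[of "real n"]]
        by (simp add: conj_commute)
      then show ?thesis
        using sub[of n] frequently_ex by fastforce
    qed
    show "K n \<subseteq> K m" if "m \<le> n" for m n
      unfolding K_def using that by (intro closure_mono hull_mono image_mono) auto
    have "K 0 \<subseteq> cball 0 B"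
      using B by (intro min) auto
    then show "bounded (K 0)"
      using bounded_cball bounded_subset by blast
  qed
  then obtain y where y: "\<And>n. y \<in> K n" by blast
  show thesis
  proof (rule that)
    fix C assume C: "closed C" "convex C" "\<forall>\<^sub>F t in at_top. P t \<longrightarrow> f t \<in> C"
    then obtain T where T: "\<And>t. t \<ge> T \<Longrightarrow> P t \<Longrightarrow> f t \<in> C"
      unfolding eventually_at_top_linorder by blast
    have "f ` {t. t \<ge> real (nat \<lceil>T\<rceil>) \<and> P t} \<subseteq> C"
      using T by (auto dest: order_trans[OF real_nat_ceiling_ge])
    then show "y \<in> C"
      using min[OF C(1,2)] y by blast
  qed
qed

text \<open>If weak convergence to a cluster point \<open>y\<close> failed in some direction
  \<open>w\<close>, the times of failure would produce another cluster point \<open>y'\<close>. Both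
  lie in \<open>S\<close>, so the squared distances to both converge, and their difference
  determines the limit of \<open>inner (y - y') (f t)\<close>. Hence \<open>y\<close> and
  \<open>y'\<close> have the same inner product with \<open>y - y'\<close>, which forces
  \<open>y = y'\<close>.\<close>

lemma opial:
  fixes f :: "real \<Rightarrow> 'a::{real_inner, complete_space}"
  assumes B: "\<forall>t\<ge>0. norm (f t) \<le> B"
    and conv: "\<And>z. z \<in> S \<Longrightarrow> \<exists>l. ((\<lambda>t. (norm (f t - z))\<^sup>2) \<longlongrightarrow> l) at_top"
    and cluster: "\<And>y. (\<And>C. \<lbrakk>closed C; convex C; \<forall>\<^sub>F t in at_top. f t \<in> C\<rbrakk> \<Longrightarrow> y \<in> C) \<Longrightarrow> y \<in> S"
  shows "\<exists>y\<in>S. weakly_tendsto f y at_top"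
proof -
  obtain y where y: "\<And>C. \<lbrakk>closed C; convex C; \<forall>\<^sub>F t in at_top. f t \<in> C\<rbrakk> \<Longrightarrow> y \<in> C"
    using bounded_closed_convex_cluster_point[OF B, where P = "\<lambda>_. True"] by auto
  have yS: "y \<in> S" using y by (rule cluster)
  have no: "\<not> (\<exists>\<^sub>F t in at_top. inner w (f t) \<ge> inner w y + e)" if e: "e > 0" for w e
  proof
    assume P: "\<exists>\<^sub>F t in at_top. inner w (f t) \<ge> inner w y + e"
    obtain y' where y': "\<And>C. \<lbrakk>closed C; convex C;
        \<forall>\<^sub>F t in at_top. inner w (f t) \<ge> inner w y + e \<longrightarrow> f t \<in> C\<rbrakk> \<Longrightarrow> y' \<in> C"
      by (fact bounded_closed_convex_cluster_point[OF B P])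
    have "y' \<in> {u. inner w u \<ge> inner w y + e}"
      by (rule y'[OF closed_halfspace_ge convex_halfspace_ge]) simp
    then have neq: "y' \<noteq> y" using e by auto
    have y'2: "y' \<in> C" if "closed C" "convex C" "\<forall>\<^sub>F t in at_top. f t \<in> C" for C
      using that by (intro y') (auto elim: eventually_mono)
    then have y'S: "y' \<in> S" by (rule cluster)
    obtain l l' where l: "((\<lambda>t. (norm (f t - y))\<^sup>2) \<longlongrightarrow> l) at_top" 
      "((\<lambda>t. (norm (f t - y'))\<^sup>2) \<longlongrightarrow> l') at_top"
      using conv[OF yS] conv[OF y'S] by blast
    \<comment> \<open>Expanding the two squared distances cancels the norm of \<open>f t\<close> and
      leaves an affine function of \<open>f t\<close> with limit \<open>L\<close>.\<close>
    define L where "L = (l' - l + inner y y - inner y' y') / 2"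
    have "((\<lambda>t. ((norm (f t - y'))\<^sup>2 - (norm (f t - y))\<^sup>2 + inner y y - inner y' y') / 2) \<longlongrightarrow> L) at_top"
      unfolding L_def by (intro tendsto_intros l) simp
    moreover have "((norm (f t - y'))\<^sup>2 - (norm (f t - y))\<^sup>2 + inner y y - inner y' y') / 2
        = inner (y - y') (f t)" for t
      by (simp add: power2_norm_eq_inner inner_simps inner_commute)
    ultimately have lim: "((\<lambda>t. inner (y - y') (f t)) \<longlongrightarrow> L) at_top"
      by simp
    \<comment> \<open>Half-spaces slightly larger than the limiting ones are closed, convex and
      eventually contain the curve, hence contain every cluster point.\<close>
    have eqL: "inner (y - y') u = L" if u: "\<And>C. \<lbrakk>closed C; convex C; \<forall>\<^sub>F t in at_top. f t \<in> C\<rbrakk> \<Longrightarrow> u \<in> C" for u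
    proof (rule antisym; rule field_le_epsilon)
      fix e :: real assume e: "e > 0"
      have "u \<in> {v. inner (y - y') v \<le> L + e}"
        by (rule u[OF closed_halfspace_le convex_halfspace_le])
           (use order_tendstoD(2)[OF lim, of "L + e"] e in \<open>auto elim!: eventually_mono\<close>)
      then show "inner (y - y') u \<le> L + e" by simp
      have "u \<in> {v. inner (y - y') v \<ge> L - e}"
        by (rule u[OF closed_halfspace_ge convex_halfspace_ge])
           (use order_tendstoD(1)[OF lim, of "L - e"] e in \<open>auto elim!: eventually_mono\<close>)
      then show "L \<le> inner (y - y') u + e" by simp
    qed
    have "inner (y - y') (y - y') = 0"
      using eqL[OF y] eqL[OF y'2] by (simp add: inner_diff_right)
    then show False using neq by simp
  qed
  have "weakly_tendsto f y at_top"
    unfolding weakly_tendsto_def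
  proof (intro allI tendstoI)
    fix w and e :: real assume e: "e > 0"
    have "\<forall>\<^sub>F t in at_top. inner w (f t) < inner w y + e" 
         "\<forall>\<^sub>F t in at_top. inner (- w) (f t) < inner (- w) y + e"
      using no[OF e, of w] no[OF e, of "- w"] by (simp_all only: not_frequently not_le)
    then show "\<forall>\<^sub>F t in at_top. dist (inner (f t) w) (inner y w) < e"
      by eventually_elim (simp add: dist_real_def inner_commute abs_less_iff)
  qed
  then show ?thesis using yS by blast
qed

section \<open>Gradients, convexity and the conjugate condition\<close>

lemma GDERIV_has_vector_derivative_compose:
  assumes f: "GDERIV f (x t) :> D" and x: "(x has_vector_derivative x') (at t within S)"
  shows "((\<lambda>s. f (x s)) has_real_derivative inner D x') (at t within S)"
proof -
  have "((\<lambda>s. f (x s)) has_derivative (\<lambda>h. inner (h *\<^sub>R x') D)) (at t within S)"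
    using has_derivative_compose[OF x[unfolded has_vector_derivative_def] f[unfolded gderiv_def]] .
  then show ?thesis
    unfolding has_field_derivative_def
    by (rule has_derivative_eq_rhs) (auto simp: inner_commute mult.commute)
qed

lemma line_derivative:
  assumes "GDERIV f x :> D"
  shows "((\<lambda>s. f (x + s *\<^sub>R h)) has_real_derivative inner D h) (at 0)"
proof (rule GDERIV_has_vector_derivative_compose)
  show "((\<lambda>s. x + s *\<^sub>R h) has_vector_derivative h) (at 0)"
    by (auto intro!: derivative_eq_intros simp: has_vector_derivative_def)
qed (use assms in simp)

text \<open>Restriction to the line through \<open>x\<close> and \<open>y\<close> reduces the
  gradient inequality to the one-dimensional one.\<close>

lemma convex_above_tangent:
  assumes cv: "convex_on UNIV f" and f: "GDERIV f x :> D"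
  shows "f x + inner D (y - x) \<le> f y"
proof -
  define \<phi> where "\<phi> s = f (x + s *\<^sub>R (y - x))" for s
  have "convex_on UNIV \<phi>"
  proof (rule convex_onI)
    fix t a b :: real assume t: "0 < t" "t < 1"
    have "x + ((1 - t) * a + t * b) *\<^sub>R (y - x) 
        = (1 - t) *\<^sub>R (x + a *\<^sub>R (y - x)) + t *\<^sub>R (x + b *\<^sub>R (y - x))"
      by (simp add: algebra_simps)
    then show "\<phi> ((1 - t) *\<^sub>R a + t *\<^sub>R b) \<le> (1 - t) * \<phi> a + t * \<phi> b"
      using convex_onD[OF cv, of t "x + a *\<^sub>R (y - x)" "x + b *\<^sub>R (y - x)"] t by (simp add: \<phi>_def)
  qed simp
  moreover have "(\<phi> has_real_derivative inner D (y - x)) (at 0)"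
    unfolding \<phi>_def by (rule line_derivative[OF f])
  ultimately have "inner D (y - x) * (1 - 0) \<le> \<phi> 1 - \<phi> 0"
    by (intro convex_on_imp_above_tangent[of UNIV]) auto
  then show ?thesis by (simp add: \<phi>_def)
qed

text \<open>A negative directional derivative would decrease \<open>f\<close> along a short initial
  piece of the segment from \<open>z\<close> to \<open>y\<close>, which stays in
  \<open>C\<close>.\<close>

lemma first_order_optimality:
  assumes f: "GDERIV f z :> D" and C: "convex C" and z: "z \<in> C" and y: "y \<in> C"
    and min: "\<And>u. u \<in> C \<Longrightarrow> f z \<le> f u"
  shows "0 \<le> inner D (y - z)"
proof (rule ccontr)
  assume "\<not> 0 \<le> inner D (y - z)"
  then obtain d where d: "d > 0" "\<And>h. \<lbrakk>0 < h; h < d\<rbrakk> \<Longrightarrow> f (z + h *\<^sub>R (y - z)) < f z"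
    using DERIV_neg_dec_right[OF line_derivative[OF f, of "y - z"]] by auto
  \<comment> \<open>Half of \<open>d\<close> stays below \<open>d\<close>, and the cap 1 keeps the
    point on the segment.\<close>
  define h where "h = min (d / 2) 1"
  have h: "0 < h" "h < d" "h \<le> 1" using d(1) by (auto simp: h_def)
  have "z + h *\<^sub>R (y - z) = (1 - h) *\<^sub>R z + h *\<^sub>R y"
    by (simp add: algebra_simps)
  then have "z + h *\<^sub>R (y - z) \<in> C"
    using convexD_alt[OF C z y, of h] h by simp
  then show False
    using min d(2)[OF h(1,2)] by fastforce
qed

lemma convex_sublevel:
  assumes "convex_on UNIV f"
  shows "convex {y. f y \<le> c}"
proof (rule convexI, unfold mem_Collect_eq)
  fix x y and u v :: real
  assume "f x \<le> c" "f y \<le> c" "0 \<le> u" "0 \<le> v" "u + v = 1"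
  then show "f (u *\<^sub>R x + v *\<^sub>R y) \<le> c"
    using assms convex_bound_le[of "f x" c "f y" u v] order_trans unfolding convex_on_def by blast
qed

lemma GDERIV_imp_continuous_on: "(\<And>y. GDERIV f y :> f' y) \<Longrightarrow> continuous_on S f"
  by (meson continuous_at_imp_continuous_on gderiv_def has_derivative_continuous)

text \<open>The support function at \<open>p / b\<close> is attained at \<open>z\<close> because
  \<open>p\<close> is normal there, and \<open>y\<close> is one candidate in the supremum defining
  the conjugate. Since \<open>ennreal\<close> sends negative numbers to 0, the positive part of the
  left side is bounded.\<close>

lemma penalty_integral_integrand_ge:
  assumes p: "p \<in> normal_cone (argmin_set \<Psi>) z" and b: "b > 0"
  shows "ennreal (inner p (y - z) - b * \<Psi> y) \<le> e2ennreal (ereal b *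
        (fenchel_conjugate \<Psi> (p /\<^sub>R b) - support_function (argmin_set \<Psi>) (p /\<^sub>R b)))"
proof -
  have z: "z \<in> argmin_set \<Psi>" and p': "\<And>y. y \<in> argmin_set \<Psi> \<Longrightarrow> inner p y \<le> inner p z"
    using p by (auto simp: normal_cone_def inner_diff_right split: if_splits)
  have sup: "support_function (argmin_set \<Psi>) (p /\<^sub>R b) = ereal (inner (p /\<^sub>R b) z)"
    unfolding support_function_def
  proof (rule antisym)
    show "(SUP x\<in>argmin_set \<Psi>. ereal (inner (p /\<^sub>R b) x)) \<le> ereal (inner (p /\<^sub>R b) z)"
      using p' b by (intro SUP_least) (simp add: mult_left_mono)
    show "ereal (inner (p /\<^sub>R b) z) \<le> (SUP x\<in>argmin_set \<Psi>. ereal (inner (p /\<^sub>R b) x))"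
      using z by (rule SUP_upper)
  qed
  have "ereal (inner (p /\<^sub>R b) y - \<Psi> y) \<le> fenchel_conjugate \<Psi> (p /\<^sub>R b)"
    unfolding fenchel_conjugate_def by (rule SUP_upper) simp
  then have "ereal (inner (p /\<^sub>R b) y - \<Psi> y) - ereal (inner (p /\<^sub>R b) z) 
      \<le> fenchel_conjugate \<Psi> (p /\<^sub>R b) - ereal (inner (p /\<^sub>R b) z)"
    by (rule ereal_minus_mono) simp
  then have "ereal b * (ereal (inner (p /\<^sub>R b) y - \<Psi> y) - ereal (inner (p /\<^sub>R b) z))
      \<le> ereal b * (fenchel_conjugate \<Psi> (p /\<^sub>R b) - ereal (inner (p /\<^sub>R b) z))"
    using b by (intro ereal_mult_left_mono) auto
  moreover have "ereal b * (ereal (inner (p /\<^sub>R b) y - \<Psi> y) - ereal (inner (p /\<^sub>R b) z)) 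
      = ereal (inner p (y - z) - b * \<Psi> y)"
    using b by (simp add: field_simps inner_diff_right)
  ultimately have "e2ennreal (ereal (inner p (y - z) - b * \<Psi> y)) \<le> e2ennreal (ereal b *
        (fenchel_conjugate \<Psi> (p /\<^sub>R b) - ereal (inner (p /\<^sub>R b) z)))"
    by (intro e2ennreal_mono) simp
  then show ?thesis
    by (simp add: sup e2ennreal_ereal)
qed

lemma normal_cone_scaleR:
  assumes "p \<in> normal_cone C z" "c \<ge> 0"
  shows "c *\<^sub>R p \<in> normal_cone C z"
  using assms by (auto simp: normal_cone_def mult_nonneg_nonpos split: if_splits)

section \<open>Lyapunov analysis\<close>

lemma inner_has_real_derivative:
  assumes "(f has_vector_derivative f') (at t within S)" "(g has_vector_derivative g') (at t within S)"
  shows "((\<lambda>s. inner (f s) (g s)) has_real_derivative inner (f t) g' + inner f' (g t)) (at t within S)"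
  using bounded_bilinear.has_vector_derivative[OF bounded_bilinear_inner assms]
  by (simp add: has_real_derivative_iff_has_vector_derivative)

text \<open>The setting after reduction to first order: \<open>x'\<close> and
  \<open>\<beta>'\<close> are tied to \<open>x\<close> and \<open>\<beta>\<close> by derivative
  assumptions, and \<open>v_deriv\<close> holds at every time, so no almost-everywhere argument
  remains.\<close>

locale damped_penalty_flow =
  fixes \<Phi> \<Psi> :: "'a::{real_inner, complete_space} \<Rightarrow> real"
    and \<beta> \<beta>' :: "real \<Rightarrow> real"
    and \<gamma> lam k \<theta> :: real
    and x x' :: "real \<Rightarrow> 'a"
  assumes pos: "\<gamma> > 0" "lam > 0"
    and \<Psi>_nonneg: "\<And>y. \<Psi> y \<ge> 0"
    and convex: "convex_on UNIV \<Phi>" "convex_on UNIV \<Psi>"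
    and grad: "\<And>y. GDERIV \<Phi> y :> gradient \<Phi> y" "\<And>y. GDERIV \<Psi> y :> gradient \<Psi> y"
    and grad_cont: "continuous_on UNIV (gradient \<Phi>)" "continuous_on UNIV (gradient \<Psi>)"
    and argmin: "argmin_set \<Psi> = \<Psi> -` {0}"
    and solvable: "bilevel_solutions \<Phi> \<Psi> \<noteq> {}"
    and bdd: "bdd_below (range \<Phi>)"
    and \<beta>_pos: "\<And>t. t \<ge> 0 \<Longrightarrow> \<beta> t > 0"
    and \<beta>_deriv: "\<And>t. t \<ge> 0 \<Longrightarrow> (\<beta> has_real_derivative \<beta>' t) (at t within {0..})"
    and \<beta>_lim: "filterlim \<beta> at_top at_top"
    and \<beta>'_bounds: "\<And>t. t \<ge> 0 \<Longrightarrow> 0 \<le> \<beta>' t \<and> \<beta>' t \<le> k * \<beta> t"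
    and \<theta>: "0 < \<theta>" "\<theta> < 1"
    and k: "(1 + lam * \<gamma>) * k < \<theta> * (2 * \<gamma> / 3)"
    and penalty: "\<And>p. p \<in> ran_normal_cone (argmin_set \<Psi>) \<Longrightarrow> penalty_integral \<Psi> \<beta> p < \<infinity>"
    and x_deriv: "\<And>t. t \<ge> 0 \<Longrightarrow> (x has_vector_derivative x' t) (at t within {0..})"
    and x'_cont: "continuous_on {0..} x'"
    and v_deriv: "\<And>t. t \<ge> 0 \<Longrightarrow>
      ((\<lambda>s. x' s + lam *\<^sub>R (gradient \<Phi> (x s) + \<beta> s *\<^sub>R gradient \<Psi> (x s))) has_vector_derivative
        - \<gamma> *\<^sub>R x' t - (gradient \<Phi> (x t) + \<beta> t *\<^sub>R gradient \<Psi> (x t))) (at t within {0..})"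
begin

definition g :: "real \<Rightarrow> 'a" where
  "g t = gradient \<Phi> (x t) + \<beta> t *\<^sub>R gradient \<Psi> (x t)"

definition v :: "real \<Rightarrow> 'a" where
  "v t = x' t + lam *\<^sub>R g t"

definition e :: "real \<Rightarrow> real" where
  "e t = \<Phi> (x t) + \<beta> t * \<Psi> (x t)"

lemma v_deriv': "t \<ge> 0 \<Longrightarrow> (v has_vector_derivative - \<gamma> *\<^sub>R x' t - g t) (at t within {0..})"
  using v_deriv unfolding v_def g_def .

lemma \<Psi>_x_deriv:
  "t \<ge> 0 \<Longrightarrow> ((\<lambda>s. \<Psi> (x s)) has_real_derivative inner (gradient \<Psi> (x t)) (x' t)) (at t within {0..})"
  by (intro GDERIV_has_vector_derivative_compose grad x_deriv)

lemma e_deriv: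
  assumes "t \<ge> 0"
  shows "(e has_real_derivative inner (g t) (x' t) + \<beta>' t * \<Psi> (x t)) (at t within {0..})"
  unfolding e_def g_def
  by (rule derivative_eq_intros GDERIV_has_vector_derivative_compose[OF grad(1) x_deriv] 
        \<beta>_deriv \<Psi>_x_deriv assms refl)+ (simp add: inner_simps algebra_simps)

lemma continuous:
  "continuous_on {0..} x" "continuous_on {0..} \<beta>" "continuous_on {0..} g" "continuous_on {0..} v"
  "continuous_on {0..} e" "continuous_on {0..} (\<lambda>t. \<Psi> (x t))" "continuous_on {0..} (\<lambda>t. \<beta> t * \<Psi> (x t))"
proof -
  show x: "continuous_on {0..} x"
    using x_deriv by (auto simp: continuous_on_eq_continuous_within intro: has_vector_derivative_continuous)
  show \<beta>: "continuous_on {0..} \<beta>"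
    using \<beta>_deriv by (auto simp: continuous_on_eq_continuous_within intro: DERIV_continuous)
  show "continuous_on {0..} e"
    using e_deriv by (auto simp: continuous_on_eq_continuous_within intro: DERIV_continuous)
  show \<Psi>: "continuous_on {0..} (\<lambda>t. \<Psi> (x t))"
    using \<Psi>_x_deriv by (auto simp: continuous_on_eq_continuous_within intro: DERIV_continuous)
  show "continuous_on {0..} (\<lambda>t. \<beta> t * \<Psi> (x t))"
    by (intro continuous_intros \<beta> \<Psi>)
  show g: "continuous_on {0..} g"
    unfolding g_def using grad_cont
    by (intro continuous_intros \<beta> continuous_on_compose2[OF _ x, of UNIV]) auto
  show "continuous_on {0..} v"
    unfolding v_def by (intro continuous_intros x'_cont g)
qed

lemma \<beta>\<Psi>_nonneg: "t \<ge> 0 \<Longrightarrow> \<beta> t * \<Psi> (x t) \<ge> 0"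
  using \<beta>_pos \<Psi>_nonneg by (simp add: less_imp_le)

definition m\<Phi> :: real where "m\<Phi> = (INF y. \<Phi> y)"

lemma m\<Phi>_le: "m\<Phi> \<le> \<Phi> y"
  unfolding m\<Phi>_def by (rule cINF_lower[OF bdd]) simp

lemma m\<Phi>_le_e: "t \<ge> 0 \<Longrightarrow> m\<Phi> \<le> e t"
  using m\<Phi>_le[of "x t"] \<beta>\<Psi>_nonneg[of t] by (simp add: e_def)

definition E :: "real \<Rightarrow> real" where
  "E t = inner (v t) (v t) / 2 + (1 + lam * \<gamma>) * e t"

definition F :: "'a \<Rightarrow> real \<Rightarrow> real" where
  "F z t = inner (v t) (x t - z) + \<gamma> / 2 * inner (x t - z) (x t - z) - lam * e t"

text \<open>The inner product of \<open>v\<close> with its derivative contains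
  \<open>- (1 + lam * \<gamma>) * inner (g t) (x' t)\<close>; the weight of \<open>e\<close> in
  \<open>E\<close> is chosen to cancel this term.\<close>

lemma E_deriv:
  assumes "t \<ge> 0"
  shows "(E has_real_derivative - \<gamma> * (norm (x' t))\<^sup>2 - lam * (norm (g t))\<^sup>2
            + (1 + lam * \<gamma>) * (\<beta>' t * \<Psi> (x t))) (at t within {0..})"
proof -
  have "(E has_real_derivative (inner (v t) (- \<gamma> *\<^sub>R x' t - g t) + inner (- \<gamma> *\<^sub>R x' t - g t) (v t)) / 2
      + (1 + lam * \<gamma>) * (inner (g t) (x' t) + \<beta>' t * \<Psi> (x t))) (at t within {0..})"
    unfolding E_def
    by (intro DERIV_add DERIV_cmult DERIV_cdivide inner_has_real_derivative v_deriv' e_deriv assms)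
  then show ?thesis
    by (rule DERIV_cong)
       (simp add: v_def inner_simps inner_commute power2_norm_eq_inner field_simps)
qed

text \<open>The quadratic term of \<open>F\<close> removes the product of \<open>x'\<close> with
  \<open>x - z\<close>, and \<open>- lam * e\<close> removes the product of \<open>g\<close> with
  \<open>x'\<close>.\<close>

lemma F_deriv:
  assumes "t \<ge> 0"
  shows "(F z has_real_derivative (norm (x' t))\<^sup>2 - lam * (\<beta>' t * \<Psi> (x t)) - inner (g t) (x t - z)) (at t within {0..})"
proof -
  have y: "((\<lambda>t. x t - z) has_vector_derivative x' t) (at t within {0..})"
    using has_vector_derivative_diff[OF x_deriv[OF assms] has_vector_derivative_const[of z]] by simp
  have "(F z has_real_derivative
      (inner (v t) (x' t) + inner (- \<gamma> *\<^sub>R x' t - g t) (x t - z))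
      + \<gamma> / 2 * (inner (x t - z) (x' t) + inner (x' t) (x t - z))
      - lam * (inner (g t) (x' t) + \<beta>' t * \<Psi> (x t))) (at t within {0..})"
    unfolding F_def
    by (intro DERIV_add DERIV_diff DERIV_cmult inner_has_real_derivative y v_deriv' e_deriv assms)
  then show ?thesis
    by (rule DERIV_cong)
       (simp add: v_def inner_simps inner_commute power2_norm_eq_inner field_simps)
qed

lemma \<beta>'\<Psi>_le: "t \<ge> 0 \<Longrightarrow> \<beta>' t * \<Psi> (x t) \<le> k * (\<beta> t * \<Psi> (x t))"
  using \<beta>'_bounds[of t] \<Psi>_nonneg[of "x t"] mult_right_mono[of "\<beta>' t" "k * \<beta> t" "\<Psi> (x t)"] by simp

text \<open>The tangent inequalities at \<open>x t\<close>, evaluated at \<open>z\<close> where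
  \<open>\<Psi>\<close> vanishes, bound \<open>inner (g t) (x t - z)\<close> below by
  \<open>e t - \<Phi> z\<close>; the term with \<open>\<beta>'\<close> has a favourable
  sign.\<close>

lemma F_deriv_le:
  assumes t: "t \<ge> 0" and z: "z \<in> bilevel_solutions \<Phi> \<Psi>"
  shows "(norm (x' t))\<^sup>2 - lam * (\<beta>' t * \<Psi> (x t)) - inner (g t) (x t - z)
    \<le> (norm (x' t))\<^sup>2 - (e t - \<Phi> z)"
proof -
  have \<Psi>z: "\<Psi> z = 0"
    using z argmin by (auto simp: bilevel_solutions_def)
  have "\<Phi> (x t) - \<Phi> z \<le> inner (gradient \<Phi> (x t)) (x t - z)"
    using convex_above_tangent[OF convex(1) grad(1), of "x t" z] by (simp add: inner_diff_right)
  moreover have "\<Psi> (x t) \<le> inner (gradient \<Psi> (x t)) (x t - z)"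
    using convex_above_tangent[OF convex(2) grad(2), of "x t" z] by (simp add: inner_diff_right \<Psi>z)
  then have "\<beta> t * \<Psi> (x t) \<le> \<beta> t * inner (gradient \<Psi> (x t)) (x t - z)"
    using \<beta>_pos[OF t] by (intro mult_left_mono) auto
  moreover have "lam * (\<beta>' t * \<Psi> (x t)) \<ge> 0"
    using pos \<beta>'_bounds[OF t] \<Psi>_nonneg by simp
  ultimately show ?thesis
    by (simp add: g_def e_def inner_add_left)
qed

section \<open>The integrable error supplied by the penalty condition\<close>

text \<open>The positive part of the lower bound for the penalty integrand at the normal vector
  \<open>- gradient \<Phi> z / (1 - \<theta>)\<close>. The factor \<open>1 / (1 - \<theta>)\<close>
  is what lets a share \<theta> of \<open>\<beta> t * \<Psi> (x t)\<close> survive in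
  \<open>e_minus_ge\<close>.\<close>

definition D :: "'a \<Rightarrow> real \<Rightarrow> real" where
  "D z t = max 0 (inner (- (1 / (1 - \<theta>)) *\<^sub>R gradient \<Phi> z) (x t - z) - \<beta> t * \<Psi> (x t))"

lemma D_continuous: "continuous_on {0..} (D z)"
  unfolding D_def by (intro continuous_intros continuous)

lemma D_nonneg: "D z t \<ge> 0"
  by (simp add: D_def)

text \<open>Optimality of \<open>z\<close> over the convex set \<open>argmin_set \<Psi>\<close>
  places \<open>- gradient \<Phi> z\<close> in the normal cone at \<open>z\<close>; so does every
  nonnegative multiple, and the penalty condition applies.\<close>

lemma D_integrable:
  assumes z: "z \<in> bilevel_solutions \<Phi> \<Psi>"
  shows "D z integrable_on {0..}"
proof (rule nn_integral_finite_imp_integrable_on_half_line[OF D_continuous D_nonneg])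
  define p where "p = - (1 / (1 - \<theta>)) *\<^sub>R gradient \<Phi> z"
  have z': "z \<in> argmin_set \<Psi>" and min: "\<And>y. y \<in> argmin_set \<Psi> \<Longrightarrow> \<Phi> z \<le> \<Phi> y"
    using z by (auto simp: bilevel_solutions_def)
  have "argmin_set \<Psi> = {y. \<Psi> y \<le> 0}"
    using \<Psi>_nonneg by (auto simp: argmin intro: antisym)
  then have "convex (argmin_set \<Psi>)"
    using convex_sublevel[OF convex(2)] by simp
  then have "- gradient \<Phi> z \<in> normal_cone (argmin_set \<Psi>) z"
    using first_order_optimality[OF grad(1) _ z' _ min] z' by (simp add: normal_cone_def)
  then have p: "p \<in> normal_cone (argmin_set \<Psi>) z"
    using normal_cone_scaleR[of "- gradient \<Phi> z" _ z "1 / (1 - \<theta>)"] \<theta> by (simp add: p_def)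
  have "(\<integral>\<^sup>+ t. ennreal (D z t) \<partial>lebesgue_on {0..}) \<le> penalty_integral \<Psi> \<beta> p"
    unfolding penalty_integral_def
  proof (rule nn_integral_mono)
    fix t :: real assume "t \<in> space (lebesgue_on {0..})"
    then have "t \<ge> 0" by simp
    have "ennreal (D z t) = ennreal (inner p (x t - z) - \<beta> t * \<Psi> (x t))"
      by (simp add: D_def p_def max_def ennreal_neg)
    also have "\<dots> \<le> e2ennreal (ereal (\<beta> t) *
        (fenchel_conjugate \<Psi> (p /\<^sub>R \<beta> t) - support_function (argmin_set \<Psi>) (p /\<^sub>R \<beta> t)))"
      by (rule penalty_integral_integrand_ge[OF p \<beta>_pos[OF \<open>t \<ge> 0\<close>]])
    finally show "ennreal (D z t) \<le> \<dots>" .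
  qed
  also have "\<dots> < \<infinity>"
    using p by (intro penalty) (auto simp: ran_normal_cone_def)
  finally show "(\<integral>\<^sup>+ t. ennreal (D z t) \<partial>lebesgue_on {0..}) < \<infinity>" .
qed

text \<open>The tangent inequality for \<Phi> at \<open>z\<close> bounds the change of \<Phi>. Of
  \<open>\<beta> t * \<Psi> (x t)\<close> a share \<open>1 - \<theta>\<close> compensates the linear
  term up to the error \<open>D\<close>, and the share \<theta> remains.\<close>

lemma e_minus_ge: "e t - \<Phi> z \<ge> \<theta> * (\<beta> t * \<Psi> (x t)) - (1 - \<theta>) * D z t"
proof -
  have "inner (gradient \<Phi> z) (x t - z) \<le> \<Phi> (x t) - \<Phi> z"
    using convex_above_tangent[OF convex(1) grad(1), of z "x t"] by simp
  moreover have "(1 - \<theta>) * (inner (- (1 / (1 - \<theta>)) *\<^sub>R gradient \<Phi> z) (x t - z) - \<beta> t * \<Psi> (x t)) \<le> (1 - \<theta>) * D z t"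
    unfolding D_def using \<theta> by (intro mult_left_mono) auto
  then have "- inner (gradient \<Phi> z) (x t - z) - (1 - \<theta>) * (\<beta> t * \<Psi> (x t)) \<le> (1 - \<theta>) * D z t"
    using \<theta> by (simp add: right_diff_distrib)
  ultimately show ?thesis
    by (simp add: e_def algebra_simps)
qed

section \<open>The coercive Lyapunov function and its dissipation\<close>

text \<open>What remains of the decay rate \<open>2 * \<gamma> / 3 * \<theta>\<close> of
  \<open>\<beta> * \<Psi>\<close> gained from \<open>F\<close> after paying for the growth of
  \<beta> in \<open>E\<close>; the bound on \<open>k\<close> makes it positive.\<close>

definition \<mu> :: real where "\<mu> = 2 * \<gamma> / 3 * \<theta> - (1 + lam * \<gamma>) * k"

lemma \<mu>_pos: "\<mu> > 0"
  using k by (simp add: \<mu>_def mult.commute)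

text \<open>The weight \<open>2 * \<gamma> / 3 < \<gamma>\<close> keeps the quadratic part in \<open>(v, x - z)\<close> positive definite,
  while the dissipation of \<open>E\<close> still absorbs the term \<open>(norm x')\<^sup>2\<close> produced by \<open>F z\<close>.\<close>

definition W :: "'a \<Rightarrow> real \<Rightarrow> real" where
  "W z t = E t + 2 * \<gamma> / 3 * F z t"

text \<open>The guaranteed dissipation of \<open>W\<close>; the coefficient
  \<open>\<gamma> / 3\<close> is \<open>\<gamma>\<close> from \<open>E\<close> less
  \<open>2 * \<gamma> / 3\<close> from \<open>F\<close>.\<close>

definition A :: "real \<Rightarrow> real" where
  "A t = \<gamma> / 3 * (norm (x' t))\<^sup>2 + lam * (norm (g t))\<^sup>2 + \<mu> * (\<beta> t * \<Psi> (x t))"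

lemma W_ge:
  assumes "t \<ge> 0"
  shows "(norm (v t))\<^sup>2 / 8 + \<gamma>\<^sup>2 / 27 * (norm (x t - z))\<^sup>2 + (1 + lam * \<gamma> / 3) * m\<Phi> \<le> W z t"
proof -
  define y where "y = x t - z"
  \<comment> \<open>This square uses 3/8 of the available 1/2 for \<open>v\<close> and 8/27 of the
    available 9/27 for \<open>y\<close> to absorb the mixed term, leaving the coefficients 1/8 and
    1/27.\<close>
  have "0 \<le> 3 / 8 * inner (v t + (8 * \<gamma> / 9) *\<^sub>R y) (v t + (8 * \<gamma> / 9) *\<^sub>R y)"
    by simp
  also have "\<dots> = 3 / 8 * inner (v t) (v t) + 2 * \<gamma> / 3 * inner (v t) y + 8 * \<gamma>\<^sup>2 / 27 * inner y y"
    by (simp add: inner_add_left inner_add_right inner_commute[of y "v t"] field_simps power2_eq_square)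
  finally have "inner (v t) (v t) / 8 + \<gamma>\<^sup>2 / 27 * inner y y
      \<le> inner (v t) (v t) / 2 + 2 * \<gamma> / 3 * inner (v t) y + \<gamma>\<^sup>2 / 3 * inner y y"
    by linarith
  also have "\<dots> + (1 + lam * \<gamma> / 3) * e t = W z t"
    unfolding W_def E_def F_def y_def[symmetric] by (simp add: algebra_simps power2_eq_square)
  finally have "(norm (v t))\<^sup>2 / 8 + \<gamma>\<^sup>2 / 27 * (norm y)\<^sup>2 + (1 + lam * \<gamma> / 3) * e t \<le> W z t"
    unfolding power2_norm_eq_inner by simp
  moreover have "(1 + lam * \<gamma> / 3) * m\<Phi> \<le> (1 + lam * \<gamma> / 3) * e t"
    using pos m\<Phi>_le_e[OF assms] by (intro mult_left_mono) auto
  ultimately show ?thesis by (simp add: y_def)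
qed

text \<open>Convexity controls the part from \<open>F\<close>, and
  \<open>\<beta>' \<le> k * \<beta>\<close> the remaining term of \<open>E\<close>. The derivative
  is quantified existentially so that a function \<open>W'\<close> can be chosen from it.\<close>

lemma W_deriv:
  assumes z: "z \<in> bilevel_solutions \<Phi> \<Psi>" and t: "t \<ge> 0"
  shows "\<exists>d. (W z has_real_derivative d) (at t within {0..}) \<and> d \<le> 2 * \<gamma> / 3 * ((1 - \<theta>) * D z t) - A t"
proof (intro exI conjI)
  define dE where "dE = - \<gamma> * (norm (x' t))\<^sup>2 - lam * (norm (g t))\<^sup>2 + (1 + lam * \<gamma>) * (\<beta>' t * \<Psi> (x t))"
  define dF where "dF = (norm (x' t))\<^sup>2 - lam * (\<beta>' t * \<Psi> (x t)) - inner (g t) (x t - z)"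
  show "(W z has_real_derivative dE + 2 * \<gamma> / 3 * dF) (at t within {0..})"
    unfolding W_def dE_def dF_def
    by (intro DERIV_add DERIV_cmult E_deriv F_deriv t)
  have "dF \<le> (norm (x' t))\<^sup>2 - \<theta> * (\<beta> t * \<Psi> (x t)) + (1 - \<theta>) * D z t"
    using F_deriv_le[OF t z] e_minus_ge[of t z] unfolding dF_def by linarith
  then have "2 * \<gamma> / 3 * dF \<le> 2 * \<gamma> / 3 * ((norm (x' t))\<^sup>2 - \<theta> * (\<beta> t * \<Psi> (x t)) + (1 - \<theta>) * D z t)"
    using pos by (intro mult_left_mono) auto
  moreover have "(1 + lam * \<gamma>) * (\<beta>' t * \<Psi> (x t)) \<le> (1 + lam * \<gamma>) * (k * (\<beta> t * \<Psi> (x t)))"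
    using pos \<beta>'\<Psi>_le[OF t] by (intro mult_left_mono) (auto intro: add_nonneg_nonneg)
  ultimately show "dE + 2 * \<gamma> / 3 * dF \<le> 2 * \<gamma> / 3 * ((1 - \<theta>) * D z t) - A t"
    unfolding dE_def A_def \<mu>_def by (simp add: algebra_simps)
qed

lemma A_continuous: "continuous_on {0..} A"
  unfolding A_def by (intro continuous_intros continuous x'_cont)

lemma A_parts_nonneg:
  assumes "t \<ge> 0"
  shows "0 \<le> \<gamma> / 3 * (norm (x' t))\<^sup>2" "0 \<le> lam * (norm (g t))\<^sup>2" "0 \<le> \<mu> * (\<beta> t * \<Psi> (x t))" "0 \<le> A t"
  using pos \<mu>_pos \<beta>\<Psi>_nonneg[OF assms] unfolding A_def by (auto intro!: add_nonneg_nonneg mult_nonneg_nonneg)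

lemma W_consequences:
  assumes z: "z \<in> bilevel_solutions \<Phi> \<Psi>"
  shows "A integrable_on {0..}" and "\<exists>B. \<forall>t\<ge>0. W z t \<le> B" and "\<exists>l. (W z \<longlongrightarrow> l) at_top"
proof -
  obtain W' where W': "\<And>t. t \<ge> 0 \<Longrightarrow> (W z has_real_derivative W' t) (at t within {0..})"
    "\<And>t. t \<ge> 0 \<Longrightarrow> W' t \<le> 2 * \<gamma> / 3 * ((1 - \<theta>) * D z t) - A t"
    using W_deriv[OF z] by metis
  have D': "continuous_on {0..} (\<lambda>t. 2 * \<gamma> / 3 * ((1 - \<theta>) * D z t))"
    by (intro continuous_intros D_continuous)
  have D'_nn: "0 \<le> 2 * \<gamma> / 3 * ((1 - \<theta>) * D z t)" for t
    using pos \<theta> D_nonneg by simp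
  have D'_int: "(\<lambda>t. 2 * \<gamma> / 3 * ((1 - \<theta>) * D z t)) integrable_on {0..}"
    by (intro integrable_on_mult_right D_integrable z)
  have lower: "(1 + lam * \<gamma> / 3) * m\<Phi> \<le> W z t" if "t \<ge> 0" for t
  proof -
    have "0 \<le> (norm (v t))\<^sup>2 / 8 + \<gamma>\<^sup>2 / 27 * (norm (x t - z))\<^sup>2" by simp
    then show ?thesis using W_ge[OF that, of z] by linarith
  qed
  note diss = dissipation[OF W' A_continuous A_parts_nonneg(4) D' D'_nn D'_int lower]
  show "A integrable_on {0..}" by (rule diss(1))
  show "\<exists>B. \<forall>t\<ge>0. W z t \<le> B" using diss(2) by blast
  show "\<exists>l. (W z \<longlongrightarrow> l) at_top" by (rule diss(3))
qed

text \<open>Each quantity, times a positive constant, is a nonnegative summand of the integrable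
  function \<open>A\<close>.\<close>

lemma integrable:
  shows "(\<lambda>t. (norm (x' t))\<^sup>2) integrable_on {0..}" and "(\<lambda>t. (norm (g t))\<^sup>2) integrable_on {0..}"
    and "(\<lambda>t. \<beta> t * \<Psi> (x t)) integrable_on {0..}"
proof -
  have A: "A integrable_on {0..}"
    using W_consequences(1) solvable by blast
  have *: "f integrable_on {0..}" if c: "c > 0" and f: "continuous_on {0..} f"
    and nn: "\<And>t. t \<ge> 0 \<Longrightarrow> 0 \<le> c * f t" and le: "\<And>t. t \<ge> 0 \<Longrightarrow> c * f t \<le> A t" for f :: "real \<Rightarrow> real" and c
  proof -
    have "(\<lambda>t. c * f t) integrable_on {0..}"
      using f nn le by (intro integrable_on_half_line_mono[OF _ A_continuous _ _ A] continuous_intros) auto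
    then have "(\<lambda>t. inverse c * (c * f t)) integrable_on {0..}"
      by (rule integrable_on_mult_right)
    then show ?thesis
      using c by (simp add: mult.assoc[symmetric])
  qed
  have le: "\<gamma> / 3 * (norm (x' t))\<^sup>2 \<le> A t" "lam * (norm (g t))\<^sup>2 \<le> A t" "\<mu> * (\<beta> t * \<Psi> (x t)) \<le> A t"
    if "t \<ge> 0" for t
    using A_parts_nonneg[OF that] unfolding A_def by linarith+
  show "(\<lambda>t. (norm (x' t))\<^sup>2) integrable_on {0..}"
    using A_parts_nonneg(1) le(1) pos by (intro *[of "\<gamma> / 3"] continuous_intros x'_cont) auto
  show "(\<lambda>t. (norm (g t))\<^sup>2) integrable_on {0..}"
    using A_parts_nonneg(2) le(2) pos by (intro *[of lam] continuous_intros continuous) auto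
  show "(\<lambda>t. \<beta> t * \<Psi> (x t)) integrable_on {0..}"
    using A_parts_nonneg(3) le(3) \<mu>_pos by (intro *[of \<mu>] continuous) auto
qed

text \<open>\<open>W\<close> is bounded above for one solution \<open>z0\<close> and controls the
  distance to \<open>z0\<close>; the triangle inequality passes to an arbitrary
  \<open>z\<close>.\<close>

lemma bounded: "\<exists>B. \<forall>t\<ge>0. norm (x t - z) \<le> B"
proof -
  obtain z0 where z0: "z0 \<in> bilevel_solutions \<Phi> \<Psi>"
    using solvable by blast
  obtain B where B: "\<And>t. t \<ge> 0 \<Longrightarrow> W z0 t \<le> B"
    using W_consequences(2)[OF z0] by blast
  define C where "C = (B - (1 + lam * \<gamma> / 3) * m\<Phi>) * 27 / \<gamma>\<^sup>2"
  have "norm (x t - z) \<le> sqrt C + norm (z0 - z)" if "t \<ge> 0" for t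
  proof -
    have "(norm (v t))\<^sup>2 / 8 \<ge> 0" by simp
    then have "\<gamma>\<^sup>2 / 27 * (norm (x t - z0))\<^sup>2 \<le> B - (1 + lam * \<gamma> / 3) * m\<Phi>"
      using W_ge[OF that, of z0] B[OF that] by linarith
    then have "(norm (x t - z0))\<^sup>2 \<le> C"
      using pos by (simp add: C_def field_simps)
    then have "norm (x t - z0) \<le> sqrt C"
      by (rule real_le_rsqrt)
    then show ?thesis
      using norm_triangle_ineq[of "x t - z0" "z0 - z"] by simp
  qed
  then show ?thesis by blast
qed

section \<open>Limits of the energies along the trajectory\<close>

lemma v_tendsto: "(v \<longlongrightarrow> 0) at_top"
proof -
  \<comment> \<open>The sum of the bounds \<open>v2\<close> and \<open>v'2\<close> for the squared
    norms of \<open>v\<close> and of its derivative. It dominates both the squared norm of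
    \<open>v\<close> and the derivative of that squared norm.\<close>
  define Dv where "Dv t = (2 + 2 * \<gamma>\<^sup>2) * (norm (x' t))\<^sup>2 + (2 * lam\<^sup>2 + 2) * (norm (g t))\<^sup>2" for t
  have sq: "(norm (a + b))\<^sup>2 \<le> 2 * (norm a)\<^sup>2 + 2 * (norm b)\<^sup>2" for a b :: 'a
    using sum_squares_bound[of "norm a" "norm b"] power_mono[OF norm_triangle_ineq[of a b], of 2]
    by (simp add: power2_sum)
  have v2: "(norm (v t))\<^sup>2 \<le> 2 * (norm (x' t))\<^sup>2 + 2 * lam\<^sup>2 * (norm (g t))\<^sup>2" for t
    using sq[of "x' t" "lam *\<^sub>R g t"] by (simp add: v_def power_mult_distrib)
  have v'2: "(norm (- \<gamma> *\<^sub>R x' t - g t))\<^sup>2 \<le> 2 * \<gamma>\<^sup>2 * (norm (x' t))\<^sup>2 + 2 * (norm (g t))\<^sup>2" for t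
    using sq[of "- \<gamma> *\<^sub>R x' t" "- g t"] by (simp add: power_mult_distrib)
  have Dv: "continuous_on {0..} Dv" "\<And>t. Dv t \<ge> 0" "Dv integrable_on {0..}"
    unfolding Dv_def
    by (auto intro!: continuous_intros x'_cont continuous integrable_add integrable_on_mult_right integrable)
  have v_le: "(norm (v t))\<^sup>2 \<le> Dv t" for t
  proof -
    have "0 \<le> 2 * \<gamma>\<^sup>2 * (norm (x' t))\<^sup>2 + 2 * (norm (g t))\<^sup>2" by simp
    moreover have "Dv t = (2 * (norm (x' t))\<^sup>2 + 2 * lam\<^sup>2 * (norm (g t))\<^sup>2)
        + (2 * \<gamma>\<^sup>2 * (norm (x' t))\<^sup>2 + 2 * (norm (g t))\<^sup>2)"
      by (simp add: Dv_def algebra_simps)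
    ultimately show ?thesis using v2[of t] by linarith
  qed
  have "((\<lambda>t. inner (v t) (v t)) \<longlongrightarrow> 0) at_top"
  proof (rule integrable_tendsto_zero)
    show "((\<lambda>t. inner (v t) (v t)) has_real_derivative 
        inner (v t) (- \<gamma> *\<^sub>R x' t - g t) + inner (- \<gamma> *\<^sub>R x' t - g t) (v t)) (at t within {0..})" if "t \<ge> 0" for t
      by (intro inner_has_real_derivative v_deriv' that)
    show "(\<lambda>t. inner (v t) (v t)) integrable_on {0..}"
      using v_le unfolding power2_norm_eq_inner
      by (intro integrable_on_half_line_mono[OF _ Dv(1) _ _ Dv(3)] continuous_intros continuous) auto
    show "inner (v t) (- \<gamma> *\<^sub>R x' t - g t) + inner (- \<gamma> *\<^sub>R x' t - g t) (v t) \<le> Dv t" for t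
    proof -
      have "2 * inner (v t) (- \<gamma> *\<^sub>R x' t - g t) \<le> (norm (v t))\<^sup>2 + (norm (- \<gamma> *\<^sub>R x' t - g t))\<^sup>2"
        using norm_cauchy_schwarz[of "v t" "- \<gamma> *\<^sub>R x' t - g t"]
          sum_squares_bound[of "norm (v t)" "norm (- \<gamma> *\<^sub>R x' t - g t)"] by linarith
      also have "\<dots> \<le> Dv t"
        using v2[of t] v'2[of t] unfolding Dv_def by (simp add: algebra_simps)
      finally show ?thesis
        by (simp add: inner_commute)
    qed
  qed (use Dv in auto)
  then have "((\<lambda>t. sqrt (inner (v t) (v t))) \<longlongrightarrow> sqrt 0) at_top"
    by (rule tendsto_real_sqrt)
  then show ?thesis
    by (simp add: norm_eq_sqrt_inner[symmetric] tendsto_norm_zero_iff)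
qed

text \<open>The only positive term in the derivative of \<open>E\<close> is at most a multiple of
  the integrable function \<open>\<beta> * \<Psi>(x)\<close>.\<close>

lemma E_tendsto: "\<exists>l. (E \<longlongrightarrow> l) at_top"
proof (rule dissipation(3))
  show "(E has_real_derivative - \<gamma> * (norm (x' t))\<^sup>2 - lam * (norm (g t))\<^sup>2
            + (1 + lam * \<gamma>) * (\<beta>' t * \<Psi> (x t))) (at t within {0..})" if "t \<ge> 0" for t
    by (rule E_deriv[OF that])
  \<comment> \<open>Replacing \<open>k\<close> by \<open>max 0 k\<close> makes the error function
    visibly nonnegative.\<close>
  define c where "c = (1 + lam * \<gamma>) * max 0 k"
  have c: "c \<ge> 0" using pos by (simp add: c_def)
  show "- \<gamma> * (norm (x' t))\<^sup>2 - lam * (norm (g t))\<^sup>2 + (1 + lam * \<gamma>) * (\<beta>' t * \<Psi> (x t))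
      \<le> c * (\<beta> t * \<Psi> (x t)) - 0" if "t \<ge> 0" for t
  proof -
    have "k * (\<beta> t * \<Psi> (x t)) \<le> max 0 k * (\<beta> t * \<Psi> (x t))"
      using \<beta>\<Psi>_nonneg[OF that] by (intro mult_right_mono) auto
    then have "(1 + lam * \<gamma>) * (\<beta>' t * \<Psi> (x t)) \<le> (1 + lam * \<gamma>) * (max 0 k * (\<beta> t * \<Psi> (x t)))"
      using \<beta>'\<Psi>_le[OF that] pos by (intro mult_left_mono) auto
    then show ?thesis
      using A_parts_nonneg(1,2)[OF that] by (simp add: c_def mult.assoc)
  qed
  show "continuous_on {0..} (\<lambda>t. c * (\<beta> t * \<Psi> (x t)))"
    by (intro continuous_intros continuous)
  show "(\<lambda>t. c * (\<beta> t * \<Psi> (x t))) integrable_on {0..}"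
    by (intro integrable_on_mult_right integrable)
  show "0 \<le> c * (\<beta> t * \<Psi> (x t))" if "t \<ge> 0" for t
    using c \<beta>\<Psi>_nonneg[OF that] by simp
  show "(1 + lam * \<gamma>) * m\<Phi> \<le> E t" if "t \<ge> 0" for t
  proof -
    have "(1 + lam * \<gamma>) * m\<Phi> \<le> (1 + lam * \<gamma>) * e t"
      using pos m\<Phi>_le_e[OF that] by (intro mult_left_mono) auto
    then show ?thesis by (simp add: E_def add_increasing)
  qed
qed auto

lemma e_tendsto: "\<exists>l. (e \<longlongrightarrow> l) at_top"
proof -
  obtain l where l: "(E \<longlongrightarrow> l) at_top" using E_tendsto by blast
  have "((\<lambda>t. (E t - inner (v t) (v t) / 2) / (1 + lam * \<gamma>))
      \<longlongrightarrow> (l - inner (0::'a) 0 / 2) / (1 + lam * \<gamma>)) at_top"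
    using pos by (intro tendsto_divide tendsto_diff tendsto_inner l v_tendsto tendsto_const)
      (auto simp: add_nonneg_eq_0_iff)
  moreover have "1 + lam * \<gamma> > 0"
    using pos by (simp add: add_pos_pos)
  then have "(E t - inner (v t) (v t) / 2) / (1 + lam * \<gamma>) = e t" for t
    unfolding E_def by simp
  ultimately show ?thesis by auto
qed

text \<open>\<open>F z\<close> is recovered as a multiple of \<open>W z - E\<close>, both of which
  converge.\<close>

lemma F_tendsto:
  assumes z: "z \<in> bilevel_solutions \<Phi> \<Psi>"
  shows "\<exists>l. (F z \<longlongrightarrow> l) at_top"
proof -
  obtain l l' where l: "(E \<longlongrightarrow> l) at_top" "(W z \<longlongrightarrow> l') at_top" 
    using E_tendsto W_consequences(3)[OF z] by blast
  have "((\<lambda>t. (W z t - E t) * (3 / (2 * \<gamma>))) \<longlongrightarrow> (l' - l) * (3 / (2 * \<gamma>))) at_top"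
    by (intro tendsto_intros l)
  moreover have "(W z t - E t) * (3 / (2 * \<gamma>)) = F z t" for t
    using pos by (simp add: W_def)
  ultimately show ?thesis by auto
qed

lemma inner_v_tendsto: "((\<lambda>t. inner (v t) (x t - z)) \<longlongrightarrow> 0) at_top"
proof -
  obtain B where B: "\<forall>t\<ge>0. norm (x t - z) \<le> B"
    using bounded[of z] ..
  have lim: "((\<lambda>t. norm (v t) * B) \<longlongrightarrow> 0) at_top"
    by (rule tendsto_mult_left_zero[OF tendsto_norm_zero[OF v_tendsto]])
  show ?thesis
  proof (rule Lim_null_comparison[OF _ lim])
    show "\<forall>\<^sub>F t in at_top. norm (inner (v t) (x t - z)) \<le> norm (v t) * B"
      using eventually_ge_at_top[of 0]
    proof eventually_elim
      case (elim t)
      then show ?case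
        using Cauchy_Schwarz_ineq2[of "v t" "x t - z"]
          mult_left_mono[OF B[rule_format, OF elim] norm_ge_zero[of "v t"]] by simp
    qed
  qed
qed

text \<open>The definition of \<open>F\<close> is solved for the squared distance: its mixed term
  tends to 0 and both \<open>F z\<close> and \<open>e\<close> converge.\<close>

lemma dist_tendsto:
  assumes z: "z \<in> bilevel_solutions \<Phi> \<Psi>"
  shows "\<exists>l. ((\<lambda>t. (norm (x t - z))\<^sup>2) \<longlongrightarrow> l) at_top"
proof -
  obtain l l' where l: "(F z \<longlongrightarrow> l) at_top" "(e \<longlongrightarrow> l') at_top" 
    using F_tendsto[OF z] e_tendsto by blast
  have "((\<lambda>t. (F z t - inner (v t) (x t - z) + lam * e t) * (2 / \<gamma>)) \<longlongrightarrow> (l - 0 + lam * l') * (2 / \<gamma>)) at_top"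
    by (intro tendsto_intros l inner_v_tendsto)
  moreover have "(F z t - inner (v t) (x t - z) + lam * e t) * (2 / \<gamma>) = (norm (x t - z))\<^sup>2" for t
  proof -
    have "F z t - inner (v t) (x t - z) + lam * e t = \<gamma> / 2 * (norm (x t - z))\<^sup>2"
      unfolding F_def power2_norm_eq_inner by linarith
    then show ?thesis using pos by simp
  qed
  ultimately show ?thesis by auto
qed

text \<open>A limit above \<open>\<Phi> z\<close> would make the integral of
  \<open>e - \<Phi> z\<close> diverge. Since the squared norm of \<open>x'\<close> is integrable,
  \<open>F z\<close> would then tend to minus infinity, although it converges.\<close>

lemma e_limit_le:
  assumes z: "z \<in> bilevel_solutions \<Phi> \<Psi>" and l: "(e \<longlongrightarrow> l) at_top"
  shows "l \<le> \<Phi> z"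
proof (rule ccontr)
  assume "\<not> l \<le> \<Phi> z"
  then have lz: "l - \<Phi> z > 0" by simp
  obtain f where f: "(F z \<longlongrightarrow> f) at_top" using F_tendsto[OF z] by blast
  have cont: "continuous_on {0..} (\<lambda>t. e t - \<Phi> z)" "continuous_on {0..} (\<lambda>t. (norm (x' t))\<^sup>2)"
    by (intro continuous_intros continuous x'_cont)+
  define I where "I = integral {0..} (\<lambda>t. (norm (x' t))\<^sup>2)"
  have step: "F z T - F z 0 \<le> I - integral {0..T} (\<lambda>t. e t - \<Phi> z)" if T: "T \<ge> 0" for T
  proof -
    have "F z T - F z 0 \<le> integral {0..T} (\<lambda>t. (norm (x' t))\<^sup>2) - integral {0..T} (\<lambda>t. e t - \<Phi> z)"
    proof (rule has_integral_le)
      show "((\<lambda>t. (norm (x' t))\<^sup>2 - lam * (\<beta>' t * \<Psi> (x t)) - inner (g t) (x t - z)) has_integral F z T - F z 0) {0..T}"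
        using F_deriv T by (intro has_integral_derivative_half_line) (auto simp: has_real_derivative_iff_has_vector_derivative)
      show "((\<lambda>t. (norm (x' t))\<^sup>2 - (e t - \<Phi> z)) has_integral
          integral {0..T} (\<lambda>t. (norm (x' t))\<^sup>2) - integral {0..T} (\<lambda>t. e t - \<Phi> z)) {0..T}"
        by (intro has_integral_diff integrable_integral integrable_continuous_real
             continuous_on_subset[OF cont(1)] continuous_on_subset[OF cont(2)]) auto
    qed (use F_deriv_le[OF _ z] in auto)
    also have "integral {0..T} (\<lambda>t. (norm (x' t))\<^sup>2) \<le> I"
      unfolding I_def by (rule integral_Icc_le_half_line[OF cont(2) _ integrable(1)]) simp
    finally show ?thesis by simp
  qed
  have "((\<lambda>t. e t - \<Phi> z) \<longlongrightarrow> l - \<Phi> z) at_top"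
    by (intro tendsto_intros l)
  \<comment> \<open>With this threshold \<open>step\<close> gives \<open>F z T < f - 1\<close>,
    against the limit \<open>f\<close> of \<open>F z\<close>.\<close>
  from integral_positive_limit_unbounded[OF cont(1) this lz, of "I + F z 0 - (f - 1)"]
  have "\<forall>\<^sub>F T in at_top. integral {0..T} (\<lambda>t. e t - \<Phi> z) > I + F z 0 - (f - 1)" .
  moreover have "\<forall>\<^sub>F T in at_top. F z T > f - 1"
    using order_tendstoD(1)[OF f] by simp
  ultimately have "\<forall>\<^sub>F T::real in at_top. False"
    using eventually_ge_at_top[of "0::real"]
  proof eventually_elim
    case (elim T)
    then show ?case using step[of T] by linarith
  qed
  then show False by simp
qed

text \<open>Since \<open>e\<close> converges and \<Phi> is bounded below,
  \<open>\<beta> * \<Psi>(x)\<close> is eventually bounded; dividing by \<beta> gives the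
  claim.\<close>

lemma \<Psi>_tendsto: "((\<lambda>t. \<Psi> (x t)) \<longlongrightarrow> 0) at_top"
proof -
  obtain l where l: "(e \<longlongrightarrow> l) at_top" using e_tendsto by blast
  have lim: "((\<lambda>t. (l + 1 - m\<Phi>) / \<beta> t) \<longlongrightarrow> 0) at_top"
    by (rule tendsto_divide_0[OF tendsto_const filterlim_at_top_imp_at_infinity[OF \<beta>_lim]])
  show ?thesis
  proof (rule tendsto_sandwich[OF _ _ tendsto_const lim])
    have "\<forall>\<^sub>F t in at_top. e t < l + 1"
      using order_tendstoD(2)[OF l] by simp
    then show "\<forall>\<^sub>F t in at_top. \<Psi> (x t) \<le> (l + 1 - m\<Phi>) / \<beta> t"
      using eventually_ge_at_top[of 0]
    proof eventually_elim
      case (elim t)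
      then have "\<beta> t * \<Psi> (x t) \<le> l + 1 - m\<Phi>"
        using m\<Phi>_le[of "x t"] by (simp add: e_def)
      then show ?case
        using \<beta>_pos[OF elim(2)] by (simp add: pos_le_divide_eq mult.commute)
    qed
  qed (simp add: \<Psi>_nonneg)
qed

section \<open>Cluster points and convergence\<close>

text \<open>Each sublevel set of \<Psi> at a positive level is closed, convex and eventually
  contains the trajectory.\<close>

lemma cluster_in_argmin:
  assumes y: "\<And>C. \<lbrakk>closed C; convex C; \<forall>\<^sub>F t in at_top. P t \<longrightarrow> x t \<in> C\<rbrakk> \<Longrightarrow> y \<in> C"
  shows "y \<in> argmin_set \<Psi>"
proof -
  have "\<Psi> y \<le> \<epsilon>" if "\<epsilon> > 0" for \<epsilon>
  proof -
    have "\<forall>\<^sub>F t in at_top. P t \<longrightarrow> x t \<in> {u. \<Psi> u \<le> \<epsilon>}"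
      using order_tendstoD(2)[OF \<Psi>_tendsto that] by (auto elim: eventually_mono)
    then have "y \<in> {u. \<Psi> u \<le> \<epsilon>}"
      by (intro y closed_Collect_le convex_sublevel convex GDERIV_imp_continuous_on[OF grad(2)] continuous_intros)
    then show ?thesis by simp
  qed
  then have "\<Psi> y \<le> 0"
    by (rule field_le_epsilon[of "\<Psi> y" 0, simplified])
  then show ?thesis
    using \<Psi>_nonneg[of y] by (simp add: argmin)
qed

text \<open>Plays the part of weak lower semicontinuity: sublevel sets of \<Phi> are closed and
  convex.\<close>

lemma cluster_\<Phi>_le:
  assumes y: "\<And>C. \<lbrakk>closed C; convex C; \<forall>\<^sub>F t in at_top. P t \<longrightarrow> x t \<in> C\<rbrakk> \<Longrightarrow> y \<in> C"
    and c: "\<forall>\<^sub>F t in at_top. P t \<longrightarrow> \<Phi> (x t) \<le> c"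
  shows "\<Phi> y \<le> c"
proof -
  have "y \<in> {u. \<Phi> u \<le> c}"
    using c by (intro y closed_Collect_le convex_sublevel convex GDERIV_imp_continuous_on[OF grad(1)] continuous_intros) simp
  then show ?thesis by simp
qed

text \<open>The limit of \<open>e\<close> bounds \<Phi> along the trajectory from above. Were \<Phi>
  repeatedly below \<open>\<Phi> z - \<epsilon>\<close>, a cluster point along those times would
  minimize \<Psi> with a smaller value of \<Phi> than \<open>z\<close>. Both limits then follow by
  squeezing, as \<open>\<beta> * \<Psi>(x)\<close> is the nonnegative difference of \<open>e\<close>
  and \<open>\<Phi>(x)\<close>.\<close>

lemma \<Phi>_and_\<beta>\<Psi>_tendsto:
  assumes z: "z \<in> bilevel_solutions \<Phi> \<Psi>"
  shows "((\<lambda>t. \<Phi> (x t)) \<longlongrightarrow> \<Phi> z) at_top" and "((\<lambda>t. \<beta> t * \<Psi> (x t)) \<longlongrightarrow> 0) at_top"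
proof -
  obtain B where B: "\<forall>t\<ge>0. norm (x t) \<le> B"
    using bounded[of 0] by auto
  obtain l where l: "(e \<longlongrightarrow> l) at_top" using e_tendsto by blast
  have lz: "l \<le> \<Phi> z" by (rule e_limit_le[OF z l])
  have lower: "\<forall>\<^sub>F t in at_top. \<Phi> (x t) > \<Phi> z - \<epsilon>" if \<epsilon>: "\<epsilon> > 0" for \<epsilon>
  proof (rule ccontr)
    assume "\<not> ?thesis"
    then have P: "\<exists>\<^sub>F t in at_top. \<Phi> (x t) \<le> \<Phi> z - \<epsilon>"
      by (simp add: frequently_def not_le)
    obtain y where y: "\<And>C. \<lbrakk>closed C; convex C;
        \<forall>\<^sub>F t in at_top. \<Phi> (x t) \<le> \<Phi> z - \<epsilon> \<longrightarrow> x t \<in> C\<rbrakk> \<Longrightarrow> y \<in> C"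
      by (fact bounded_closed_convex_cluster_point[OF B P])
    have "y \<in> argmin_set \<Psi>"
      using y by (rule cluster_in_argmin[where P = "\<lambda>t. \<Phi> (x t) \<le> \<Phi> z - \<epsilon>"])
    then have "\<Phi> z \<le> \<Phi> y"
      using z by (auto simp: bilevel_solutions_def)
    moreover have "\<Phi> y \<le> \<Phi> z - \<epsilon>"
      by (rule cluster_\<Phi>_le[where P = "\<lambda>t. \<Phi> (x t) \<le> \<Phi> z - \<epsilon>"])
         (rule y, assumption+, rule always_eventually, simp)
    ultimately show False using \<epsilon> by simp
  qed
  have upper: "\<forall>\<^sub>F t in at_top. e t < \<Phi> z + \<epsilon>" if \<epsilon>: "\<epsilon> > 0" for \<epsilon>
    using order_tendstoD(2)[OF l, of "\<Phi> z + \<epsilon>"] lz \<epsilon> by simp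
  show \<Phi>: "((\<lambda>t. \<Phi> (x t)) \<longlongrightarrow> \<Phi> z) at_top"
  proof (rule tendstoI)
    fix \<epsilon> :: real assume \<epsilon>: "\<epsilon> > 0"
    show "\<forall>\<^sub>F t in at_top. dist (\<Phi> (x t)) (\<Phi> z) < \<epsilon>"
      using lower[OF \<epsilon>] upper[OF \<epsilon>] eventually_ge_at_top[of 0]
    proof eventually_elim
      case (elim t)
      then show ?case
        using \<beta>\<Psi>_nonneg[of t] by (simp add: e_def dist_real_def)
    qed
  qed
  show "((\<lambda>t. \<beta> t * \<Psi> (x t)) \<longlongrightarrow> 0) at_top"
  proof (rule tendstoI)
    fix \<epsilon> :: real assume \<epsilon>: "\<epsilon> > 0"
    then have \<epsilon>2: "\<epsilon> / 2 > 0" by simp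
    show "\<forall>\<^sub>F t in at_top. dist (\<beta> t * \<Psi> (x t)) 0 < \<epsilon>"
      using lower[OF \<epsilon>2] upper[OF \<epsilon>2] eventually_ge_at_top[of 0]
    proof eventually_elim
      case (elim t)
      then show ?case
        using \<beta>\<Psi>_nonneg[of t] by (simp add: e_def dist_real_def)
    qed
  qed
qed

lemma weak_convergence: "\<exists>y\<in>bilevel_solutions \<Phi> \<Psi>. weakly_tendsto x y at_top"
proof -
  obtain B where B: "\<forall>t\<ge>0. norm (x t) \<le> B"
    using bounded[of 0] by auto
  obtain z where z: "z \<in> bilevel_solutions \<Phi> \<Psi>" using solvable by blast
  show ?thesis
  proof (rule opial[OF B])
    show "\<exists>l. ((\<lambda>t. (norm (x t - z))\<^sup>2) \<longlongrightarrow> l) at_top" if "z \<in> bilevel_solutions \<Phi> \<Psi>" for z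
      by (rule dist_tendsto[OF that])
  next
    fix y assume y: "\<And>C. \<lbrakk>closed C; convex C; \<forall>\<^sub>F t in at_top. x t \<in> C\<rbrakk> \<Longrightarrow> y \<in> C"
    \<comment> \<open>The cluster lemmas work along a predicate on times, here constantly
      true.\<close>
    have y': "y \<in> C" if "closed C" "convex C" "\<forall>\<^sub>F t in at_top. True \<longrightarrow> x t \<in> C" for C
      using that by (intro y) auto
    have "\<Phi> y \<le> \<Phi> z + \<epsilon>" if "\<epsilon> > 0" for \<epsilon>
      using order_tendstoD(2)[OF \<Phi>_and_\<beta>\<Psi>_tendsto(1)[OF z], of "\<Phi> z + \<epsilon>"] that
      by (intro cluster_\<Phi>_le[where P = "\<lambda>_. True"] y') (auto elim: eventually_mono)
    then have "\<Phi> y \<le> \<Phi> z"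
      by (rule field_le_epsilon)
    moreover have "y \<in> argmin_set \<Psi>"
      using y' by (rule cluster_in_argmin[where P = "\<lambda>_. True"])
    ultimately show "y \<in> bilevel_solutions \<Phi> \<Psi>"
      using z by (force simp: bilevel_solutions_def)
  qed
qed

end

section \<open>From the second-order equation to the first-order form\<close>

text \<open>The equation identifies the almost-everywhere derivative of the velocity plus \<lambda>
  times the gradient term with a continuous function free of Hessians; absolute continuity of the
  velocity extends the identity to every time.\<close>

lemma strong_global_solution_first_order:
  fixes \<Phi> \<Psi> :: "'a::{real_inner, complete_space} \<Rightarrow> real"
  assumes td: "twice_differentiable \<Phi>" "twice_differentiable \<Psi>"
    and hess: "continuous_on UNIV (hessian \<Phi>)" "continuous_on UNIV (hessian \<Psi>)"
    and \<beta>: "hl_C1 \<beta>"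
    and sol: "strong_global_solution \<gamma> lam \<Phi> \<Psi> \<beta> u0 v0 x"
  shows "\<And>t. t \<ge> 0 \<Longrightarrow> (x has_vector_derivative hl_deriv x t) (at t within {0..})"
    and "continuous_on {0..} (hl_deriv x)"
    and "\<And>t. t \<ge> 0 \<Longrightarrow>
      ((\<lambda>s. hl_deriv x s + lam *\<^sub>R (gradient \<Phi> (x s) + \<beta> s *\<^sub>R gradient \<Psi> (x s))) has_vector_derivative
        - \<gamma> *\<^sub>R hl_deriv x t - (gradient \<Phi> (x t) + \<beta> t *\<^sub>R gradient \<Psi> (x t))) (at t within {0..})"
proof -
  have ac: "hl_locally_abs_continuous (hl_deriv x)" and diff: "x differentiable_on {0..}"
    and ode: "AE t in lebesgue_on {0..}.
        hl_deriv x differentiable (at t within {0..}) \<and>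
        hl_deriv (hl_deriv x) t + \<gamma> *\<^sub>R hl_deriv x t
          + lam *\<^sub>R blinfun_apply (hessian \<Phi> (x t)) (hl_deriv x t)
          + (lam * \<beta> t) *\<^sub>R blinfun_apply (hessian \<Psi> (x t)) (hl_deriv x t)
          + gradient \<Phi> (x t) + (\<beta> t + lam * hl_deriv \<beta> t) *\<^sub>R gradient \<Psi> (x t) = 0"
    using sol unfolding strong_global_solution_def by blast+
  show x: "(x has_vector_derivative hl_deriv x t) (at t within {0..})" if "t \<ge> 0" for t
    using diff that unfolding differentiable_on_def hl_deriv_def by (simp add: vector_derivative_works)
  show x': "continuous_on {0..} (hl_deriv x)"
    using ac unfolding hl_locally_abs_continuous_def
    by (intro continuous_on_half_lineI abs_continuous_imp_continuous_on) simp
  have \<beta>d: "(\<beta> has_vector_derivative hl_deriv \<beta> t) (at t within {0..})" if "t \<ge> 0" for t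
    using \<beta> that unfolding hl_C1_def differentiable_on_def hl_deriv_def by (simp add: vector_derivative_works)
  have \<beta>': "continuous_on {0..} (hl_deriv \<beta>)"
    using \<beta> by (simp add: hl_C1_def)
  have xc: "continuous_on {0..} x"
    using x by (auto simp: continuous_on_eq_continuous_within intro: has_vector_derivative_continuous)
  have \<beta>c: "continuous_on {0..} \<beta>"
    using \<beta>d by (auto simp: continuous_on_eq_continuous_within intro: has_vector_derivative_continuous)
  have grad_x: "((\<lambda>s. gradient f (x s)) has_vector_derivative blinfun_apply (hessian f (x t)) (hl_deriv x t)) (at t within {0..})"
    if "twice_differentiable f" "t \<ge> 0" for f t
    using has_derivative_compose[OF x[OF that(2), unfolded has_vector_derivative_def] twice_differentiableD(2)[OF that(1)]]
    by (simp add: has_vector_derivative_def blinfun.scaleR_right)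
  have grad_c: "continuous_on UNIV (gradient f)" if "twice_differentiable f" for f :: "'a \<Rightarrow> real"
    using twice_differentiableD(2)[OF that] 
    by (auto simp: continuous_on_eq_continuous_within intro: has_derivative_continuous)
  \<comment> \<open>Chain and product rule for \<lambda> times the gradient term. Continuity of the
    Hessians makes \<open>g'\<close> continuous.\<close>
  define g' where "g' t = lam *\<^sub>R (blinfun_apply (hessian \<Phi> (x t)) (hl_deriv x t)
      + (\<beta> t *\<^sub>R blinfun_apply (hessian \<Psi> (x t)) (hl_deriv x t) + hl_deriv \<beta> t *\<^sub>R gradient \<Psi> (x t)))" for t
  show "((\<lambda>s. hl_deriv x s + lam *\<^sub>R (gradient \<Phi> (x s) + \<beta> s *\<^sub>R gradient \<Psi> (x s))) has_vector_derivative
        - \<gamma> *\<^sub>R hl_deriv x t - (gradient \<Phi> (x t) + \<beta> t *\<^sub>R gradient \<Psi> (x t))) (at t within {0..})"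
    if "t \<ge> 0" for t
  proof (rule abs_continuous_ae_derivative_imp_C1[where f = "hl_deriv x" and g' = g'
        and g = "\<lambda>s. lam *\<^sub>R (gradient \<Phi> (x s) + \<beta> s *\<^sub>R gradient \<Psi> (x s))"
        and h = "\<lambda>t. - \<gamma> *\<^sub>R hl_deriv x t - (gradient \<Phi> (x t) + \<beta> t *\<^sub>R gradient \<Psi> (x t))"])
    show "hl_locally_abs_continuous (hl_deriv x)" "t \<ge> 0" by fact+
    show g: "((\<lambda>s. lam *\<^sub>R (gradient \<Phi> (x s) + \<beta> s *\<^sub>R gradient \<Psi> (x s))) has_vector_derivative g' t) (at t within {0..})"
      if "t \<ge> 0" for t
      unfolding g'_def using that td
      by (intro bounded_linear.has_vector_derivative[OF bounded_linear_scaleR_right] has_vector_derivative_add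
          bounded_bilinear.has_vector_derivative[OF bounded_bilinear_scaleR] grad_x \<beta>d) auto
    show "continuous_on {0..} g'"
      unfolding g'_def
      by (intro continuous_intros x' \<beta>' \<beta>c continuous_on_compose2[OF hess(1) xc] continuous_on_compose2[OF hess(2) xc]
           continuous_on_compose2[OF grad_c[OF td(2)] xc]) auto
    show "continuous_on {0..} (\<lambda>t. - \<gamma> *\<^sub>R hl_deriv x t - (gradient \<Phi> (x t) + \<beta> t *\<^sub>R gradient \<Psi> (x t)))"
      by (intro continuous_intros x' \<beta>c continuous_on_compose2[OF grad_c[OF td(1)] xc]
           continuous_on_compose2[OF grad_c[OF td(2)] xc]) auto
    show "AE t in lebesgue_on {0..}. 
       ((\<lambda>s. hl_deriv x s + lam *\<^sub>R (gradient \<Phi> (x s) + \<beta> s *\<^sub>R gradient \<Psi> (x s))) has_vector_derivative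
        - \<gamma> *\<^sub>R hl_deriv x t - (gradient \<Phi> (x t) + \<beta> t *\<^sub>R gradient \<Psi> (x t))) (at t within {0..})"
      using ode AE_space
    proof eventually_elim
      case (elim t)
      then have t: "t \<ge> 0" by simp
      have "(hl_deriv x has_vector_derivative hl_deriv (hl_deriv x) t) (at t within {0..})"
        using elim(1) unfolding hl_deriv_def[of "hl_deriv x"] by (simp add: vector_derivative_works)
      note deriv = has_vector_derivative_add[OF this g[OF t]]
      \<comment> \<open>Regrouping the equation: \<open>g' t\<close> collects the Hessian terms and
        the term with \<open>hl_deriv \<beta>\<close>.\<close>
      have "hl_deriv (hl_deriv x) t + g' t + (\<gamma> *\<^sub>R hl_deriv x t + (gradient \<Phi> (x t) + \<beta> t *\<^sub>R gradient \<Psi> (x t)))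
          = hl_deriv (hl_deriv x) t + \<gamma> *\<^sub>R hl_deriv x t
          + lam *\<^sub>R blinfun_apply (hessian \<Phi> (x t)) (hl_deriv x t)
          + (lam * \<beta> t) *\<^sub>R blinfun_apply (hessian \<Psi> (x t)) (hl_deriv x t)
          + gradient \<Phi> (x t) + (\<beta> t + lam * hl_deriv \<beta> t) *\<^sub>R gradient \<Psi> (x t)"
        by (simp add: g'_def algebra_simps)
      also have "\<dots> = 0" using elim(1) by simp
      finally have "hl_deriv (hl_deriv x) t + g' t
          = - \<gamma> *\<^sub>R hl_deriv x t - (gradient \<Phi> (x t) + \<beta> t *\<^sub>R gradient \<Psi> (x t))"
        by (simp add: eq_neg_iff_add_eq_0 algebra_simps)
      with deriv show ?case by simp
    qed
  qed
qed

theorem theorem7: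
  fixes \<Phi> \<Psi> :: "'a::{real_inner, complete_space} \<Rightarrow> real"
    and \<beta> :: "real \<Rightarrow> real"
    and \<gamma> lam k \<theta> :: real
    and u0 v0 :: 'a
    and x :: "real \<Rightarrow> 'a"
  assumes "\<gamma> > 0" and "lam > 0"
    and "\<forall>y. \<Psi> y \<ge> 0" and "convex_on UNIV \<Psi>" and "twice_differentiable \<Psi>"
    and "\<exists>L. L-lipschitz_on UNIV (gradient \<Psi>)" and "\<exists>L. L-lipschitz_on UNIV (hessian \<Psi>)"
    and "argmin_set \<Psi> = \<Psi> -` {0}" and "argmin_set \<Psi> \<noteq> {}"
    and "convex_on UNIV \<Phi>" and "twice_differentiable \<Phi>" and "bdd_below (range \<Phi>)"
    and "\<exists>L. L-lipschitz_on UNIV (gradient \<Phi>)" and "\<exists>L. L-lipschitz_on UNIV (hessian \<Phi>)"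
    and "bilevel_solutions \<Phi> \<Psi> \<noteq> {}"
    and "\<forall>t\<ge>0. \<beta> t > 0" and "hl_C1 \<beta>" and "filterlim \<beta> at_top at_top"
    and "\<forall>t\<ge>0. 0 \<le> hl_deriv \<beta> t \<and> hl_deriv \<beta> t \<le> k * \<beta> t"
    and "0 < \<theta>" and "\<theta> < 1"
    and "0 < k" and "k < \<theta> / (1 + lam * \<gamma>) * min (2 * \<gamma> / 3) (2 / lam)"
    and "\<forall>p\<in>ran_normal_cone (argmin_set \<Psi>). penalty_integral \<Psi> \<beta> p < \<infinity>"
    and "strong_global_solution \<gamma> lam \<Phi> \<Psi> \<beta> u0 v0 x"
  shows "((\<lambda>t. \<Phi> (x t)) \<longlongrightarrow> (INF y\<in>argmin_set \<Psi>. \<Phi> y)) at_top \<and>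
    ((\<lambda>t. \<beta> t * \<Psi> (x t)) \<longlongrightarrow> 0) at_top \<and> ((\<lambda>t. \<Psi> (x t)) \<longlongrightarrow> 0) at_top \<and>
    (\<integral>\<^sup>+ t. ennreal (\<beta> t * \<Psi> (x t)) \<partial>lebesgue_on {0..}) < \<infinity> \<and>
    hl_L2 (hl_deriv x) \<and> hl_L2 (\<lambda>t. gradient \<Phi> (x t) + \<beta> t *\<^sub>R gradient \<Psi> (x t)) \<and>
    ((\<lambda>t. hl_deriv x t + lam *\<^sub>R gradient \<Phi> (x t) + (lam * \<beta> t) *\<^sub>R gradient \<Psi> (x t))
           \<longlongrightarrow> 0) at_top \<and>
    (\<exists>x_inf\<in>bilevel_solutions \<Phi> \<Psi>. weakly_tendsto x x_inf at_top)"
proof -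
  have cont: "continuous_on UNIV (gradient \<Phi>)" "continuous_on UNIV (gradient \<Psi>)"
    "continuous_on UNIV (hessian \<Phi>)" "continuous_on UNIV (hessian \<Psi>)"
    using assms(6,7,13,14) by (auto intro: lipschitz_on_continuous_on)
  note first_order = strong_global_solution_first_order[OF assms(11,5) cont(3,4) assms(17,25)]
  interpret damped_penalty_flow \<Phi> \<Psi> \<beta> "hl_deriv \<beta>" \<gamma> lam k \<theta> x "hl_deriv x"
  proof
    show "GDERIV \<Phi> y :> gradient \<Phi> y" "GDERIV \<Psi> y :> gradient \<Psi> y" for y
      using assms(5,11) twice_differentiableD(1) by blast+
    show "(\<beta> has_real_derivative hl_deriv \<beta> t) (at t within {0..})" if "t \<ge> 0" for t
      using assms(17) that unfolding hl_C1_def differentiable_on_def hl_deriv_def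
      by (simp add: vector_derivative_works has_real_derivative_iff_has_vector_derivative)
    have c: "1 + lam * \<gamma> > 0" using assms(1,2) by (simp add: add_pos_pos)
    have "\<theta> / (1 + lam * \<gamma>) * min (2 * \<gamma> / 3) (2 / lam) \<le> \<theta> / (1 + lam * \<gamma>) * (2 * \<gamma> / 3)"
      using c assms(20) by (intro mult_left_mono) auto
    with assms(23) have "k < \<theta> / (1 + lam * \<gamma>) * (2 * \<gamma> / 3)"
      by (rule less_le_trans)
    then have "k < \<theta> * (2 * \<gamma> / 3) / (1 + lam * \<gamma>)"
      by (simp only: times_divide_eq_left)
    then show "(1 + lam * \<gamma>) * k < \<theta> * (2 * \<gamma> / 3)"
      using c unfolding pos_less_divide_eq[OF c] by (simp only: mult.commute)
  qed (use assms cont first_order in auto)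
  obtain z where z: "z \<in> bilevel_solutions \<Phi> \<Psi>" using assms(15) by blast
  \<comment> \<open>A solution attains the infimum, so convergence to \<open>\<Phi> z\<close> is the
    convergence claimed.\<close>
  have "(INF y\<in>argmin_set \<Psi>. \<Phi> y) = \<Phi> z"
    by (rule cInf_eq_minimum) (use z in \<open>auto simp: bilevel_solutions_def\<close>)
  moreover have "(\<integral>\<^sup>+ t. ennreal (\<beta> t * \<Psi> (x t)) \<partial>lebesgue_on {0..}) < \<infinity>"
    by (rule nn_integral_half_line_finite[OF \<beta>\<Psi>_nonneg integrable(3)])
  moreover have "hl_L2 (hl_deriv x)"
    by (rule hl_L2I[OF x'_cont integrable(1)])
  moreover have "hl_L2 (\<lambda>t. gradient \<Phi> (x t) + \<beta> t *\<^sub>R gradient \<Psi> (x t))"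
    using hl_L2I[OF continuous(3) integrable(2)] by (simp add: g_def[abs_def])
  moreover have "((\<lambda>t. hl_deriv x t + lam *\<^sub>R gradient \<Phi> (x t) + (lam * \<beta> t) *\<^sub>R gradient \<Psi> (x t)) \<longlongrightarrow> 0) at_top"
    using v_tendsto by (simp add: v_def[abs_def] g_def scaleR_add_right add.assoc)
  ultimately show ?thesis
    using \<Phi>_and_\<beta>\<Psi>_tendsto[OF z] \<Psi>_tendsto weak_convergence by simp
qed

end
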